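(* Let $r\ge 1$ be an integer and suppose that $A\subseteq\mathbb{F}_2^r$ is round. If $|A|>\frac{11}{36}\,2^r+3$, then there are a sum-free set $S\subseteq\mathbb{F}_2^r$ and an element $g\in\mathbb{F}_2^r$ such that $A=g+(S\cup\{0\})$.
   Context: $\mathbb{F}_2^r$ denotes the elementary abelian $2$-group of rank $r$. For $X\subseteq\mathbb{F}_2^r$, $2X:=\{x_1+x_2\colon x_1,x_2\in X\}$ (with $x_1=x_2$ allowed), and $g+X:=\{g+x\colon x\in X\}$. A set $A\subseteq\mathbb{F}_2^r$ is round if $2B\ne 2A$ for every proper subset $B\subsetneq A$. A set $S$ is sum-free if $S\cap 2S=\varnothing$. *)

theory Defs
  imports
    "HOL-Analysis.Finite_Cartesian_Product"
    "HOL-Library.Set_Algebras"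
    "HOL-Library.Z2"
begin

text \<open>The sumset $2X$ is \<open>X + X\<close> and the translate $g + X$ is \<open>g +o X\<close>.
  The group $\mathbb{F}_2^r$ is \<open>bit ^ 'r\<close> with $r = $ \<open>CARD('r)\<close>, which is automatically
  at least 1.\<close>

instance bit :: finite
proof
  have "(UNIV :: bit set) = {0, 1}"
    by (auto intro: bit.exhaust)
  then show "finite (UNIV :: bit set)"
    by (metis finite.simps)
qed

definition round_set :: "'a::plus set \<Rightarrow> bool" where
  "round_set A \<longleftrightarrow> (\<forall>B. B \<subset> A \<longrightarrow> B + B \<noteq> A + A)"

definition sum_free :: "'a::plus set \<Rightarrow> bool" where
  "sum_free S \<longleftrightarrow> S \<inter> (S + S) = {}"

end

theory Submission
  imports Defs
begin

text \<open>
  Call \<open>a, b \<in> A\<close> adjacent if \<open>a + b\<close> has no other representation as a sum of two elements of \<open>A\<close>.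
  Roundness says that no vertex of this graph is isolated, and the conclusion says that some vertex
  is adjacent to all the others.  Write \<open>n\<close> for the order of the group, \<open>U\<close> for the set of uniquely
  represented sums, \<open>\<alpha> = |A|\<close> and \<open>w = |U|\<close>.

  For an edge \<open>ab\<close> the sets \<open>A + a\<close>, \<open>A + b\<close>, \<open>U\<close>, \<open>U + a + b\<close> are almost disjoint, whence
  \<open>\<alpha> + w \<le> n/2 + deg a + deg b\<close>.  As \<open>\<alpha>\<close> is the sum of \<open>1/deg a + 1/deg b\<close> over all edges, this
  leaves only two possibilities: \<open>w \<ge> \<alpha> - 2\<close> or \<open>w \<le> n/2 - \<alpha> + 2\<close>.

  In the first one there are no three disjoint edges, so two vertices dominate the graph.  If neither
  of them is adjacent to everything, their neighbourhoods yield disjoint sets \<open>B1, B2\<close> such that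
  \<open>B1 + B2\<close> avoids \<open>B1 \<union> B2\<close>, and these are too large to coexist.

  In the second one let \<open>f(x) = |A \<inter> (A + x)|\<close> and \<open>h(x) = |U \<inter> (U + x)|\<close> for a sum \<open>x\<close> of two distinct
  elements of \<open>U\<close>.  Up to small errors \<open>f(x) \<ge> h(x) + 2\<alpha> - n/2\<close> (count in the cosets of the four-element
  group generated by the two summands) and \<open>f(x) + h(x) \<le> w\<close> (the set \<open>A \<inter> (A + x)\<close> contains no edge).
  Summing both bounds over \<open>x\<close> contradicts \<open>\<Sum> f(x) \<le> \<alpha>\<^sup>2 - \<alpha>\<close> and \<open>\<Sum> h(x) = w\<^sup>2 - w\<close>.
\<close>

section \<open>Groups of exponent two\<close>

class boolean_group = finite + ab_group_add +
  assumes add_self [simp]: "x + x = 0"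
begin

lemma add_self_left [simp]: "x + (x + y) = y"
  by (simp flip: add.assoc)

lemma add_eq_iff_right: "x + y = z \<longleftrightarrow> y = x + z"
  by auto

end

instance bit :: boolean_group
proof
  show "x + x = 0" for x :: bit
    by (cases x) auto
qed

instance vec :: (boolean_group, finite) boolean_group
  by standard (simp add: vec_eq_iff)

lemma sum_translate:
  fixes F :: "'a::boolean_group \<Rightarrow> real"
  shows "(\<Sum>x\<in>UNIV. F (x + t)) = (\<Sum>x\<in>UNIV. F x)"
  by (rule sum.reindex_bij_witness[of _ "\<lambda>x. x + t" "\<lambda>x. x + t"]) (auto simp: add.assoc)

lemma sum_of_bool_UNIV: "(\<Sum>x\<in>UNIV. of_bool (P x)) = real (card {x::'a::finite. P x})"
  by (simp add: sum.If_cases of_bool_def)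

lemma card_translate: "card {x::'a::boolean_group. P (x + t)} = card {x. P x}"
proof -
  have "real (card {x. P (x + t)}) = real (card {x. P x})"
    using sum_translate[of "\<lambda>x. of_bool (P x)" t] by (simp add: sum_of_bool_UNIV)
  then show ?thesis by simp
qed

lemma card_translate_conj:
  fixes P Q :: "'a::boolean_group \<Rightarrow> bool"
  shows "card {x. P (x + s) \<and> Q (x + t)} = card {x. P x \<and> Q (x + (s + t))}"
  using card_translate[of "\<lambda>x. P x \<and> Q (x + (s + t))" s] by (simp add: ac_simps)

lemma card_translate_image: "card ((+) t ` S) = card (S :: 'a::boolean_group set)"
  by (simp add: card_image)

text \<open>
  The smaller set \<open>B1\<close> is almost closed under addition: \<open>b + B1\<close> leaves \<open>B1\<close> in fewer than a third of
  its points for each \<open>b \<in> B1\<close>.  Therefore \<open>K = B1 + B1\<close> is a subgroup containing \<open>B1\<close>; it misses \<open>B2\<close>,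
  and \<open>B2\<close> loses a translate of \<open>B1\<close> in each coset of \<open>K\<close> that it meets.
\<close>

lemma two_class_bound:
  fixes B1 B2 :: "'a::boolean_group set"
  assumes disj: "B1 \<inter> B2 = {}" and ne: "B1 \<noteq> {}" "B2 \<noteq> {}"
    and avoid: "\<And>b c. b \<in> B1 \<Longrightarrow> c \<in> B2 \<Longrightarrow> b + c \<notin> B1 \<union> B2"
    and le: "card B1 \<le> card B2"
  shows "5 * (card B1 + card B2) \<le> 3 * CARD('a)"
proof (rule ccontr)
  define n where "n = CARD('a)"
  \<comment> \<open>The number of points outside \<open>B1\<close>, \<open>B2\<close> and
    \<open>b + B2\<close>, for any \<open>b\<close> in \<open>B1\<close>. The translate
    \<open>b + B1\<close> can leave \<open>B1\<close> only into these points.\<close>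
  define \<epsilon> where "\<epsilon> = n - card B1 - 2 * card B2"
  assume "\<not> ?thesis"
  then have big: "3 * n < 5 * (card B1 + card B2)" by (simp add: n_def)
  define N where "N t = card ((+) t ` B1 - B1)" for t
  define Z where "Z = - (B1 \<union> B2)"
  have cC: "card (Z) = n - (card B1 + card B2)"
    using disj by (simp add: Z_def Compl_eq_Diff_UNIV card_Diff_subset n_def card_Un_disjoint)
  have sub: "(+) b ` B2 \<subseteq> Z" if "b \<in> B1" for b
    using avoid[OF that] by (auto simp: Z_def)
  obtain b0 where b0: "b0 \<in> B1" using ne by auto
  have b2: "card B2 \<le> n - (card B1 + card B2)"
    using card_mono[OF finite sub[OF b0]] unfolding cC card_translate_image .
  have "card B1 + card B2 \<le> n"
    using disj card_mono[of UNIV "B1 \<union> B2"] by (simp add: card_Un_disjoint n_def)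
  then have eps: "\<epsilon> + card B1 + 2 * card B2 = n"
    using b2 by (simp add: \<epsilon>_def)
  have N1: "N b \<le> \<epsilon>" if b: "b \<in> B1" for b
  proof -
    have "(+) b ` B1 - B1 \<subseteq> Z - (+) b ` B2"
    proof
      fix x assume x: "x \<in> (+) b ` B1 - B1"
      then obtain y where y: "y \<in> B1" "x = b + y" by auto
      have "x \<notin> B2"
        using avoid[OF b, of x] y by auto
      moreover have "x \<notin> (+) b ` B2"
        using y disj by auto
      ultimately show "x \<in> Z - (+) b ` B2"
        using x by (auto simp: Z_def)
    qed
    then have "N b \<le> card (Z - (+) b ` B2)"
      unfolding N_def by (intro card_mono) auto
    also have "\<dots> = n - (card B1 + card B2) - card B2"
      using sub[OF b] by (simp add: card_Diff_subset cC card_translate_image)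
    finally show ?thesis by (simp add: \<epsilon>_def)
  qed
  have N_add: "N (s + t) \<le> N s + N t" for s t
  proof -
    have "(+) (s + t) ` B1 - B1 \<subseteq> ((+) s ` ((+) t ` B1 - B1)) \<union> ((+) s ` B1 - B1)"
      by (auto simp: ac_simps image_iff)
    then have "N (s + t) \<le> card (((+) s ` ((+) t ` B1 - B1)) \<union> ((+) s ` B1 - B1))"
      unfolding N_def by (intro card_mono) auto
    also have "\<dots> \<le> N t + N s"
      unfolding N_def by (metis card_Un_le card_translate_image)
    finally show ?thesis by simp
  qed
  define K where "K = B1 + B1"
  have KI: "b + c \<in> K" if "b \<in> B1" "c \<in> B1" for b c
    using that by (auto simp: K_def set_plus_def)
  have three: "b + c + d \<in> K" if "b \<in> B1" "c \<in> B1" "d \<in> B1" for b c d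
  proof -
    have "N (b + c + d) \<le> 3 * \<epsilon>"
      using N_add[of "b + c" d] N_add[of b c] N1[OF that(1)] N1[OF that(2)] N1[OF that(3)] by linarith
    \<comment> \<open>By \<open>eps\<close> and \<open>big\<close>, \<open>3 * \<epsilon>\<close> is
      less than \<open>2 * card B1 - card B2\<close>; here \<open>card B1 \<le> card B2\<close>
      enters.\<close>
    also have "\<dots> < card B1"
      using eps big le by presburger
    finally have "N (b + c + d) < card ((+) (b + c + d) ` B1)"
      by (simp add: card_translate_image)
    then have "(+) (b + c + d) ` B1 - B1 \<noteq> (+) (b + c + d) ` B1"
      unfolding N_def by auto
    then obtain y where "y \<in> B1" "b + c + d + y \<in> B1" by auto
    then have "(b + c + d + y) + y \<in> K" by (intro KI)
    then show ?thesis by (simp add: add.assoc)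
  qed
  have K_add: "x + y \<in> K" if x: "x \<in> K" and y: "y \<in> K" for x y
  proof -
    obtain b c where bc: "b \<in> B1" "c \<in> B1" "y = b + c"
      using y by (auto simp: K_def elim: set_plus_elim)
    obtain b' c' where "b' \<in> B1" "c' \<in> B1" "x = b' + c'"
      using x by (auto simp: K_def elim: set_plus_elim)
    then have "x + b \<in> K" using three bc(1) by simp
    then obtain d e where "d \<in> B1" "e \<in> B1" "x + b = d + e"
      by (auto simp: K_def set_plus_def)
    then have "x + b + c \<in> K"
      using three[OF _ _ bc(2)] by simp
    then show ?thesis by (simp add: bc(3) add.assoc)
  qed
  have K0: "0 \<in> K" using KI[OF b0 b0] by simp
  have B1K: "B1 \<subseteq> K" using three[OF _ b0 b0] by (auto simp: add.assoc)
  have B2K: "B2 \<inter> K = {}"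
  proof -
    have "b + c \<notin> B2" if "b \<in> B1" "c \<in> B1" for b c
      using avoid[OF that(1), of "b + c"] that(2) by auto
    then show ?thesis by (auto simp: K_def elim!: set_plus_elim)
  qed
  define k where "k = card K"
  have k1: "card B1 \<le> k" using B1K by (simp add: k_def card_mono)
  have k2: "2 * k \<le> n"
  proof -
    obtain c where c: "c \<in> B2" using ne by auto
    have "c + x \<notin> K" if "x \<in> K" for x
      using K_add[OF _ that, of "c + x"] B2K c by (auto simp: add.assoc)
    then have "K \<inter> (+) c ` K = {}" by auto
    then have "card (K \<union> (+) c ` K) = 2 * k"
      by (simp add: card_Un_disjoint card_translate_image k_def)
    then show ?thesis
      using card_mono[of UNIV "K \<union> (+) c ` K"] by (simp add: n_def)
  qed
  have coset: "card (B2 \<inter> (+) y ` K) \<le> k - card B1" if "y \<notin> K" for y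
  proof (cases "B2 \<inter> (+) y ` K = {}")
    case False
    then obtain c where c: "c \<in> B2" "c \<in> (+) y ` K" by auto
    obtain z where z: "z \<in> K" "c = y + z" using c(2) by auto
    have "(+) c ` B1 \<subseteq> (+) y ` K"
      using B1K K_add[OF z(1)] by (auto simp: z(2) add.assoc)
    moreover have "(+) c ` B1 \<inter> B2 = {}"
      using avoid c(1) by (auto simp: add.commute)
    ultimately have "B2 \<inter> (+) y ` K \<subseteq> (+) y ` K - (+) c ` B1" by auto
    then have "card (B2 \<inter> (+) y ` K) \<le> card ((+) y ` K - (+) c ` B1)"
      by (intro card_mono) auto
    also have "\<dots> = k - card B1"
      using \<open>(+) c ` B1 \<subseteq> (+) y ` K\<close> by (simp add: card_Diff_subset card_translate_image k_def)
    finally show ?thesis .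
  qed simp
  \<comment> \<open>Double counting of pairs \<open>(y, c)\<close> with \<open>y\<close> outside
    \<open>K\<close> and \<open>c\<close> in both \<open>B2\<close> and \<open>y + K\<close>: each
    \<open>c\<close> occurs with the \<open>k\<close> elements \<open>y\<close> of
    \<open>c + K\<close>, none of which lies in \<open>K\<close>.\<close>
  have "k * card B2 = (\<Sum>c\<in>B2. card {y. y \<in> - K \<and> c \<in> (+) y ` K})"
  proof -
    have "{y. y \<in> - K \<and> c \<in> (+) y ` K} = (+) c ` K" if "c \<in> B2" for c
    proof (intro set_eqI iffI)
      fix y assume "y \<in> {y. y \<in> - K \<and> c \<in> (+) y ` K}"
      then obtain z where "z \<in> K" "c = y + z" by auto
      then show "y \<in> (+) c ` K" by (intro image_eqI[of _ _ z]) (auto simp: add.assoc)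
    next
      fix y assume "y \<in> (+) c ` K"
      then obtain z where z: "z \<in> K" "y = c + z" by auto
      moreover have "y \<notin> K"
        using K_add[OF _ z(1), of y] z B2K that by (auto simp: add.assoc)
      moreover have "c \<in> (+) y ` K"
        using z by (intro image_eqI[of _ _ z]) (auto simp: add.assoc)
      ultimately show "y \<in> {y. y \<in> - K \<and> c \<in> (+) y ` K}" by simp
    qed
    then show ?thesis by (simp add: card_translate_image k_def)
  qed
  also have "\<dots> = (\<Sum>y\<in>- K. card (B2 \<inter> (+) y ` K))"
    unfolding Int_def
    by (rule sum_multicount_gen[of "- K" B2 "\<lambda>y c. c \<in> (+) y ` K", symmetric]) auto
  also have "\<dots> \<le> (n - k) * (k - card B1)"
    using sum_bounded_above[of "- K" "\<lambda>y. card (B2 \<inter> (+) y ` K)" "k - card B1"] coset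
    by (simp add: Compl_eq_Diff_UNIV card_Diff_subset n_def k_def)
  finally have main: "k * card B2 \<le> (n - k) * (k - card B1)" .
  define \<xi> where "\<xi> = real (card B1) + card B2"
  define x b1 m where "x = real k" and "b1 = real (card B1)" and "m = real n"
  have main': "x * (\<xi> - b1) \<le> (m - x) * (x - b1)"
  proof -
    have "real (k * card B2) \<le> real ((n - k) * (k - card B1))"
      using main by (rule of_nat_mono)
    then show ?thesis using k1 k2 by (simp add: x_def b1_def m_def \<xi>_def)
  qed
  have x2: "2 * x \<le> m" and m0: "0 < m" using k2 by (auto simp: x_def m_def n_def)
  \<comment> \<open>Nonnegativity of \<open>\<epsilon>\<close> bounds \<open>b1\<close> from below.
    Collected in \<open>main'\<close>, \<open>b1\<close> has the nonnegative coefficient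
    \<open>m - 2 * x\<close>, so it can be eliminated.\<close>
  have "2 * \<xi> - m \<le> b1"
    using eps by (simp add: \<xi>_def b1_def m_def)
  then have "(2 * \<xi> - m) * (m - 2 * x) \<le> b1 * (m - 2 * x)"
    using x2 by (intro mult_right_mono) auto
  with main' have "\<xi> * (2 * m - 3 * x) \<le> m * m - m * x - x * x"
    by (simp add: algebra_simps)
  moreover have "3 * m * (2 * m - 3 * x) < 5 * \<xi> * (2 * m - 3 * x)"
  proof (rule mult_strict_right_mono)
    show "3 * m < 5 * \<xi>" using big by (simp add: \<xi>_def m_def)
    show "0 < 2 * m - 3 * x" using x2 m0 by linarith
  qed
  ultimately have "(m - 2 * x)\<^sup>2 + x\<^sup>2 < 0"
    by (simp add: power2_eq_square algebra_simps)
  then show False using not_sum_power2_lt_zero by blast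
qed

section \<open>Pointwise inequalities between indicators\<close>

lemma bool_two_point:
  "\<not> (b0 \<and> b1) \<Longrightarrow> of_bool a0 + of_bool a1 + of_bool b0 + of_bool b1 - (1::real)
    \<le> of_bool (a0 \<and> a1) + of_bool (a0 \<and> b0) + of_bool (a1 \<and> b1) + of_bool (a0 \<and> b1) + of_bool (a1 \<and> b0)"
  by (cases a0; cases a1; cases b0; cases b1) simp_all

text \<open>The four indices are the points of a coset of a four-element group; \<open>a\<close>
  stands for membership in a translate of \<open>A\<close>, and \<open>b\<close> for membership in
  \<open>U\<close> without one point. Summed over the group, the first two terms on the right become
  values of \<open>rep\<close>, the negative ones nearly values of \<open>urep\<close>, and all
  others are small in \<open>rep_lower\<close>.\<close>

lemma bool_four_point:
  "\<not> (b0 \<and> bu) \<Longrightarrow> \<not> (bv \<and> bp) \<Longrightarrow> of_bool a0 + of_bool au + of_bool av + of_bool ap - (1::real)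
    \<le> of_bool (a0 \<and> ap) + of_bool (au \<and> av) - of_bool (b0 \<and> bp) - of_bool (bu \<and> bv)
      + of_bool (a0 \<and> au) + of_bool (av \<and> ap) + of_bool (a0 \<and> av) + of_bool (au \<and> ap)
      + of_bool (a0 \<and> b0) + of_bool (au \<and> bu) + of_bool (av \<and> bv) + of_bool (ap \<and> bp)
      + of_bool (a0 \<and> bu) + of_bool (au \<and> b0) + of_bool (av \<and> bp) + of_bool (ap \<and> bv)"
  by (cases a0; cases au; cases av; cases ap; cases b0; cases bu; cases bv; cases bp) simp_all

section \<open>The graph of unique sums\<close>

locale sum_graph =
  fixes A :: "'a::boolean_group set"
begin

definition adj :: "'a \<Rightarrow> 'a \<Rightarrow> bool" where
  "adj a b \<longleftrightarrow> a \<in> A \<and> b \<in> A \<and> a \<noteq> b \<and> (\<forall>c\<in>A. \<forall>d\<in>A. c + d = a + b \<longrightarrow> c = a \<or> c = b)"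

definition U :: "'a set" where
  "U = {a + b | a b. adj a b}"

definition nb :: "'a \<Rightarrow> 'a set" where
  "nb a = {b. adj a b}"

definition deg :: "'a \<Rightarrow> nat" where
  "deg a = card (nb a)"

text \<open>The autocorrelation of \<open>A\<close>. It counts ordered representations, so the
  elements of \<open>U\<close> have value 2, not 1.\<close>

definition rep :: "'a \<Rightarrow> nat" where
  "rep x = card {a \<in> A. a + x \<in> A}"

definition urep :: "'a \<Rightarrow> nat" where
  "urep x = card {u \<in> U. u + x \<in> U}"

lemma adj_sym: "adj a b \<Longrightarrow> adj b a"
  unfolding adj_def by (auto simp: add.commute)

lemma adjD: "adj a b \<Longrightarrow> a \<in> A" "adj a b \<Longrightarrow> b \<in> A" "adj a b \<Longrightarrow> a \<noteq> b"
  by (auto simp: adj_def)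

lemma adj_in_U: "adj a b \<Longrightarrow> a + b \<in> U"
  by (auto simp: U_def)

lemma adj_unique: "adj a b \<Longrightarrow> c \<in> A \<Longrightarrow> d \<in> A \<Longrightarrow> c + d = a + b \<Longrightarrow> c = a \<and> d = b \<or> c = b \<and> d = a"
  unfolding adj_def by (metis add_self_left add.commute)

lemma in_U_adj:
  assumes "a \<in> A" "b \<in> A" "a + b \<in> U"
  shows "adj a b"
proof -
  obtain c d where cd: "adj c d" "a + b = c + d"
    using assms(3) by (auto simp: U_def)
  then show ?thesis
    using adj_unique[OF cd(1) assms(1,2)] adj_sym by blast
qed

lemma deg_pos: "adj a b \<Longrightarrow> 1 \<le> deg a"
  by (auto simp: deg_def nb_def Suc_le_eq card_gt_0_iff)

lemma edge_set: "adj a b \<Longrightarrow> {x \<in> A. x + (a + b) \<in> A} = {a, b}"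
proof -
  assume ab: "adj a b"
  have "x = a \<or> x = b" if "x \<in> A" "x + (a + b) \<in> A" for x
    using adj_unique[OF ab that] by auto
  then show ?thesis
    using adjD[OF ab] by (auto simp: ac_simps)
qed

lemma rep_U: "u \<in> U \<Longrightarrow> rep u = 2"
proof -
  assume "u \<in> U"
  then obtain a b where ab: "adj a b" and u: "u = a + b" by (auto simp: U_def)
  show ?thesis
    using adjD(3)[OF ab] by (simp add: rep_def u edge_set[OF ab])
qed

lemma card_translate_rep: "card {x. x + a \<in> A \<and> x + t + a \<in> A} = rep t"
proof -
  have "card {x. x + a \<in> A \<and> x + t + a \<in> A} = card {x. (\<lambda>y. y \<in> A \<and> y + t \<in> A) (x + a)}"
    by (simp add: ac_simps)
  also have "\<dots> = card {y. y \<in> A \<and> y + t \<in> A}"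
    by (rule card_translate)
  finally show ?thesis by (simp add: rep_def)
qed

text \<open>If \<open>x\<close> lies in both \<open>A + a\<close> and \<open>U\<close>, then
  \<open>x = a + (x + a)\<close> is a uniquely represented sum, so \<open>x + a\<close> is a
  neighbour of \<open>a\<close>. Excluding the sum of the edge itself excludes the neighbour
  \<open>b\<close>.\<close>

lemma card_conflict:
  assumes "adj a b"
  shows "card {x. x + a \<in> A \<and> x \<in> U - {a + b}} = deg a - 1"
proof -
  have "{x. x + a \<in> A \<and> x \<in> U - {a + b}} = (+) a ` (nb a - {b})"
  proof (intro set_eqI iffI)
    fix x assume x: "x \<in> {x. x + a \<in> A \<and> x \<in> U - {a + b}}"
    then have "adj a (x + a)"
      by (intro in_U_adj) (use adjD[OF assms] in \<open>auto simp: ac_simps\<close>)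
    moreover have "x + a \<noteq> b"
      using x by (auto simp: ac_simps)
    ultimately show "x \<in> (+) a ` (nb a - {b})"
      by (intro image_eqI[of _ _ "x + a"]) (auto simp: nb_def ac_simps)
  next
    fix x assume "x \<in> (+) a ` (nb a - {b})"
    then obtain y where y: "adj a y" "y \<noteq> b" "x = a + y" by (auto simp: nb_def)
    then show "x \<in> {x. x + a \<in> A \<and> x \<in> U - {a + b}}"
      using adjD[OF y(1)] adj_in_U[OF y(1)] by (auto simp: ac_simps)
  qed
  moreover have "b \<in> nb a" using assms by (simp add: nb_def)
  ultimately show ?thesis
    by (simp add: card_translate_image deg_def card_Diff_singleton)
qed

lemma card_conflict':
  assumes "adj a b"
  shows "card {x. x + a \<in> A \<and> x + (a + b) \<in> U - {a + b}} = deg b - 1"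
proof -
  have "card {x. x + a \<in> A \<and> x + (a + b) \<in> U - {a + b}}
     = card {x. (\<lambda>y. y + b \<in> A \<and> y \<in> U - {b + a}) (x + (a + b))}"
    by (simp add: ac_simps)
  also have "\<dots> = card {y. y + b \<in> A \<and> y \<in> U - {b + a}}"
    by (rule card_translate)
  also have "\<dots> = deg b - 1"
    by (rule card_conflict[OF adj_sym[OF assms]])
  finally show ?thesis .
qed

section \<open>Averaging over cosets of small subgroups\<close>

lemma four_point_bound:
  "4 * real (card A) - CARD('a) \<le> 2 * real (rep u) + 2 * real (rep v) + 2 * real (rep (u + v))"
proof -
  have sums: "(\<Sum>x\<in>UNIV. of_bool (x + s \<in> A \<and> x + t \<in> A) :: real) = rep (s + t)" for s t
    using card_translate_conj[of "\<lambda>x. x \<in> A" s "\<lambda>x. x \<in> A" t]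
    by (simp add: sum_of_bool_UNIV rep_def)
  have sums0: "(\<Sum>x\<in>UNIV. of_bool (x \<in> A \<and> x + t \<in> A) :: real) = rep t" for t
    using sums[of 0 t] by simp
  have sumA: "(\<Sum>x\<in>UNIV. of_bool (x + t \<in> A) :: real) = card A" for t
    using sum_translate[of "\<lambda>x. of_bool (x \<in> A)" t] by (simp add: sum_of_bool_UNIV)
  have sumA0: "(\<Sum>x\<in>UNIV. of_bool (x \<in> A) :: real) = card A"
    using sumA[of 0] by simp
  \<comment> \<open>If \<open>j\<close> of the four points lie in \<open>A\<close>, then
    \<open>j - 1\<close> is at most the number \<open>j * (j - 1) / 2\<close> of pairs among them.
    Each of \<open>u\<close>, \<open>v\<close>, \<open>u + v\<close> is the difference of two of the
    six pairs.\<close>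
  have "(\<Sum>x\<in>UNIV. of_bool (x \<in> A) + of_bool (x + u \<in> A) + of_bool (x + v \<in> A)
            + of_bool (x + (u + v) \<in> A) - 1 :: real)
     \<le> (\<Sum>x\<in>UNIV. of_bool (x \<in> A \<and> x + u \<in> A) + of_bool (x + v \<in> A \<and> x + (u + v) \<in> A)
          + of_bool (x \<in> A \<and> x + v \<in> A) + of_bool (x + u \<in> A \<and> x + (u + v) \<in> A)
          + of_bool (x \<in> A \<and> x + (u + v) \<in> A) + of_bool (x + u \<in> A \<and> x + v \<in> A))"
    by (intro sum_mono) auto
  then show ?thesis
    by (simp add: sum.distrib sum_subtractf sums sums0 sumA sumA0 ac_simps)
qed

lemma sum_free_U:
  assumes large: "CARD('a) + 12 < 4 * card A" and "u \<in> U" "v \<in> U"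
  shows "u + v \<notin> U"
proof
  assume "u + v \<in> U"
  then have "4 * real (card A) - CARD('a) \<le> 12"
    using four_point_bound[of u v] assms by (simp add: rep_U)
  then show False using large by linarith
qed

lemma edge_bound:
  assumes large: "CARD('a) + 12 < 4 * card A" and ab: "adj a b"
  shows "real (card A) + card U \<le> CARD('a) / 2 + deg a + deg b"
proof -
  define w where "w = a + b"
  \<comment> \<open>\<open>P x\<close> and \<open>P (x + w)\<close> say that \<open>x\<close> lies
    in \<open>A + a\<close> and in \<open>A + b\<close>. As \<open>w\<close> belongs to both
    translates, dropping it from \<open>U\<close> costs one element but removes a conflict with
    each.\<close>
  define P where "P x \<longleftrightarrow> x + a \<in> A" for x
  define Q where "Q x \<longleftrightarrow> x \<in> U - {w}" for x
  have wU: "w \<in> U" using ab by (simp add: w_def adj_in_U)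
  have nQ: "\<not> (Q x \<and> Q (x + w))" for x
    using sum_free_U[OF large, of x "x + w"] wU by (auto simp: Q_def)
  have cPP: "card {x. P x \<and> P (x + w)} = 2"
    using card_translate_rep[of a w] rep_U[OF wU] by (simp add: P_def ac_simps)
  have cPQ: "card {x. P x \<and> Q x} = deg a - 1"
    using card_conflict[OF ab] by (simp add: P_def Q_def w_def)
  have cPQ': "card {x. P x \<and> Q (x + w)} = deg b - 1"
    using card_conflict'[OF ab] by (simp add: P_def Q_def w_def)
  have cP: "card {x. P x} = card A"
    using card_translate[of "\<lambda>x. x \<in> A" a] by (simp add: P_def)
  have "{x. Q x} = U - {w}" by (auto simp: Q_def)
  then have cQ: "card {x. Q x} = card U - 1"
    using wU by (simp add: card_Diff_singleton)
  note tr = card_translate[of P w] card_translate[of Q w]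
    card_translate[of "\<lambda>x. P x \<and> Q x" w] card_translate_conj[of P w Q 0, simplified]
  have "(\<Sum>x\<in>UNIV. of_bool (P x) + of_bool (P (x + w)) + of_bool (Q x) + of_bool (Q (x + w)) - (1::real))
    \<le> (\<Sum>x\<in>UNIV. of_bool (P x \<and> P (x + w)) + of_bool (P x \<and> Q x) + of_bool (P (x + w) \<and> Q (x + w))
        + of_bool (P x \<and> Q (x + w)) + of_bool (P (x + w) \<and> Q x))"
    by (intro sum_mono bool_two_point nQ)
  then have "2 * real (card A) + 2 * real (card U - 1) - CARD('a)
     \<le> 2 + 2 * real (deg a - 1) + 2 * real (deg b - 1)"
    by (simp add: sum.distrib sum_subtractf sum_of_bool_UNIV tr cPP cPQ cPQ' cP cQ)
  moreover have "1 \<le> deg a" "1 \<le> deg b" "1 \<le> card U"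
    using deg_pos[OF ab] deg_pos[OF adj_sym[OF ab]] wU by (auto simp: Suc_le_eq card_gt_0_iff)
  ultimately show ?thesis by (simp)
qed

text \<open>Sum \<open>bool_four_point\<close> over the cosets of \<open>{0, w, v, p}\<close>, where
  \<open>w = a + b\<close> and \<open>p = w + v\<close>. The errors come from
  \<open>rep w = rep v = 2\<close>, from the neighbours of \<open>a\<close> and \<open>b\<close>
  counted in \<open>card_conflict\<close>, and from the at most two points that
  \<open>urep p\<close> loses when \<open>w\<close> is dropped from \<open>U\<close>.\<close>

lemma rep_lower:
  assumes large: "CARD('a) + 12 < 4 * card A" and ab: "adj a b" and v: "v \<in> U" "v \<noteq> a + b"
  shows "real (urep (a + b + v)) + 2 * card A \<le> rep (a + b + v) + CARD('a) / 2 + 2 + 2 * (deg a + deg b)"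
proof -
  define w where "w = a + b"
  define p where "p = w + v"
  define P where "P x \<longleftrightarrow> x + a \<in> A" for x
  define Q where "Q x \<longleftrightarrow> x \<in> U - {w}" for x
  have wU: "w \<in> U" using ab by (simp add: w_def adj_in_U)
  have nQ: "\<not> (Q x \<and> Q (x + w))" for x
    using sum_free_U[OF large, of x "x + w"] wU by (auto simp: Q_def)
  have nQ': "\<not> (Q (x + v) \<and> Q (x + p))" for x
    using nQ[of "x + v"] by (simp add: p_def ac_simps)
  have cPP: "card {x. P x \<and> P (x + t)} = rep t" for t
    using card_translate_rep[of a t] by (simp add: P_def ac_simps)
  have cPQ: "card {x. P x \<and> Q x} = deg a - 1"
    using card_conflict[OF ab] by (simp add: P_def Q_def w_def)
  have cPQ': "card {x. P x \<and> Q (x + w)} = deg b - 1"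
    using card_conflict'[OF ab] by (simp add: P_def Q_def w_def)
  have cP: "card {x. P x} = card A"
    using card_translate[of "\<lambda>x. x \<in> A" a] by (simp add: P_def)
  have cQQ: "real (urep p) - 2 \<le> card {x. Q x \<and> Q (x + p)}"
  proof -
    have "{u \<in> U. u + p \<in> U} \<subseteq> {x. Q x \<and> Q (x + p)} \<union> {w, w + p}"
      by (auto simp: Q_def add_eq_iff_right add.commute)
    then have "urep p \<le> card ({x. Q x \<and> Q (x + p)} \<union> {w, w + p})"
      unfolding urep_def by (intro card_mono) auto
    also have "\<dots> \<le> card {x. Q x \<and> Q (x + p)} + card {w, w + p}"
      by (rule card_Un_le)
    also have "card {w, w + p} \<le> 2" by (simp add: card_insert_if)
    finally show ?thesis by linarith
  qed
  note tr = card_translate[of P] card_translate_conj[of P _ P] card_translate_conj[of Q _ Q]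
    card_translate_conj[of P _ Q] card_translate_conj[of P _ Q 0, simplified]
  have ps: "w + v = p" "w + p = v" "v + p = w" "v + w = p" "p + w = v" "p + v = w"
    by (simp_all add: p_def ac_simps)
  have "(\<Sum>x\<in>UNIV. of_bool (P x) + of_bool (P (x + w)) + of_bool (P (x + v)) + of_bool (P (x + p)) - (1::real))
    \<le> (\<Sum>x\<in>UNIV. of_bool (P x \<and> P (x + p)) + of_bool (P (x + w) \<and> P (x + v))
         - of_bool (Q x \<and> Q (x + p)) - of_bool (Q (x + w) \<and> Q (x + v))
      + of_bool (P x \<and> P (x + w)) + of_bool (P (x + v) \<and> P (x + p))
      + of_bool (P x \<and> P (x + v)) + of_bool (P (x + w) \<and> P (x + p))
      + of_bool (P x \<and> Q x) + of_bool (P (x + w) \<and> Q (x + w))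
      + of_bool (P (x + v) \<and> Q (x + v)) + of_bool (P (x + p) \<and> Q (x + p))
      + of_bool (P x \<and> Q (x + w)) + of_bool (P (x + w) \<and> Q x)
      + of_bool (P (x + v) \<and> Q (x + p)) + of_bool (P (x + p) \<and> Q (x + v)))"
    by (intro sum_mono bool_four_point nQ nQ')
  then have "4 * real (card A) - CARD('a) \<le> 2 * real (rep p) - 2 * card {x. Q x \<and> Q (x + p)}
      + 2 * rep w + 2 * rep v + 4 * real (deg a - 1) + 4 * real (deg b - 1)"
    by (simp add: sum.distrib sum_subtractf sum_of_bool_UNIV tr ps cPP cPQ cPQ' cP)
  moreover have "1 \<le> deg a" "1 \<le> deg b"
    using deg_pos[OF ab] deg_pos[OF adj_sym[OF ab]] by auto
  ultimately have "2 * real (urep p) + 4 * real (card A) \<le> CARD('a) + 2 * real (rep p) + 4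
      + 4 * real (deg a) + 4 * real (deg b)"
    using cQQ rep_U[OF wU] rep_U[OF v(1)] by simp
  then show ?thesis by (simp add: p_def w_def)
qed

text \<open>A substitute for \<open>rep_lower\<close> when degrees are large: no degrees enter, but
  the gain \<open>urep\<close> is lost.\<close>

lemma rep_lower_crude:
  assumes "u \<in> U" "v \<in> U"
  shows "2 * real (card A) \<le> rep (u + v) + CARD('a) / 2 + 4"
  using four_point_bound[of u v] assms by (simp add: rep_U)

text \<open>
  Counts the pairs \<open>(b, v)\<close> with \<open>b\<close> adjacent to both \<open>v\<close> and \<open>v + x\<close>: the only way in which an edge at a
  vertex of \<open>A \<inter> (A + x)\<close> can have its sum in \<open>U \<inter> (U + x)\<close>.
\<close>

definition exc :: "'a \<Rightarrow> nat" where
  "exc x = (\<Sum>b\<in>A. card {v \<in> nb b. v + x \<in> nb b})"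

text \<open>Send each vertex \<open>v\<close> of \<open>R\<close> to the sum of an edge at
  \<open>v\<close>. This is injective, since an edge \<open>v v'\<close> inside \<open>R\<close>
  would have the second representation \<open>(v + x) + (v' + x)\<close>. So \<open>U\<close>
  contains \<open>rep x\<close> images and the \<open>urep x\<close> elements of \<open>H\<close>,
  with an overlap of at most \<open>exc x\<close>.\<close>

lemma rep_urep_upper:
  assumes nonisol: "\<And>a. a \<in> A \<Longrightarrow> \<exists>b. adj a b" and x: "x \<notin> U" "x \<noteq> 0"
  shows "rep x + urep x \<le> card U + exc x"
proof -
  define R where "R = {v \<in> A. v + x \<in> A}"
  define H where "H = {u \<in> U. u + x \<in> U}"
  obtain e where e: "\<And>v. v \<in> A \<Longrightarrow> adj v (e v)"
    using nonisol by metis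
  define g where "g v = v + e v" for v
  have inj: "inj_on g R"
  proof (rule inj_onI)
    fix v v' assume v: "v \<in> R" "v' \<in> R" "g v = g v'"
    then have vA: "v \<in> A" "v' \<in> A" "v + x \<in> A" "v' + x \<in> A" by (auto simp: R_def)
    have "v = v' \<and> e v = e v' \<or> v = e v' \<and> e v = v'"
      using adj_unique[OF e[OF vA(2)] vA(1) adjD(2)[OF e[OF vA(1)]]] v(3) by (simp add: g_def)
    moreover have False if "v = e v'" "e v = v'"
    proof -
      have adj: "adj v v'" using e[OF vA(1)] that by simp
      have "v + x + (v' + x) = v + v'" by (simp add: ac_simps)
      then have "v + x = v \<or> v + x = v'"
        using adj_unique[OF adj vA(3,4)] by blast
      then have "x = 0 \<or> x = v + v'"
        by (metis add_self add_self_left)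
      then show False
        using x adj_in_U[OF adj] by blast
    qed
    ultimately show "v = v'" by blast
  qed
  have gU: "g ` R \<subseteq> U"
    using adj_in_U[OF e] by (auto simp: R_def g_def)
  let ?E = "SIGMA b:A. {v \<in> nb b. v + x \<in> nb b}"
  have "g ` R \<inter> H \<subseteq> (\<lambda>(b, v). v + b) ` ?E"
  proof
    fix u assume "u \<in> g ` R \<inter> H"
    then obtain v where v: "v \<in> A" "v + x \<in> A" "u = v + e v" "u + x \<in> U"
      by (auto simp: R_def H_def g_def)
    have "adj (v + x) (e v)"
      using v adjD(2)[OF e[OF v(1)]] by (intro in_U_adj) (auto simp: ac_simps)
    then have "(e v, v) \<in> ?E"
      using adj_sym[OF e[OF v(1)]] adj_sym adjD(2)[OF e[OF v(1)]] by (simp add: nb_def)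
    then show "u \<in> (\<lambda>(b, v). v + b) ` ?E"
      using v(3) by (intro image_eqI[of _ _ "(e v, v)"]) auto
  qed
  then have "card (g ` R \<inter> H) \<le> card ((\<lambda>(b, v). v + b) ` ?E)"
    by (intro card_mono) auto
  also have "\<dots> \<le> card ?E" by (intro card_image_le) auto
  also have "\<dots> = exc x" by (simp add: exc_def)
  finally have "card (g ` R \<inter> H) \<le> exc x" .
  moreover have "card (g ` R \<union> H) \<le> card U"
    using gU by (intro card_mono) (auto simp: H_def)
  moreover have "card (g ` R) + card H = card (g ` R \<union> H) + card (g ` R \<inter> H)"
    by (intro card_Un_Int) auto
  moreover have "card (g ` R) = rep x"
    using card_image[OF inj] by (simp add: rep_def R_def)
  moreover have "card H = urep x" by (simp add: urep_def H_def)
  ultimately show ?thesis by linarith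
qed

section \<open>Double counting over ordered edges\<close>

lemma card_pairs:
  assumes "S \<subseteq> U"
  shows "card {(v, b). adj v b \<and> v + b \<in> S} = 2 * card S"
proof -
  have two: "card {(v, b). adj v b \<and> v + b = u} = 2" if "u \<in> S" for u
  proof -
    obtain c d where cd: "adj c d" "u = c + d"
      using assms \<open>u \<in> S\<close> by (auto simp: U_def)
    have "{(v, b). adj v b \<and> v + b = u} = {(c, d), (d, c)}"
    proof (intro set_eqI iffI)
      fix p assume "p \<in> {(v, b). adj v b \<and> v + b = u}"
      then obtain v b where "p = (v, b)" "adj v b" "v + b = c + d" using cd(2) by auto
      then show "p \<in> {(c, d), (d, c)}"
        using adj_unique[OF cd(1) adjD(1,2)[OF \<open>adj v b\<close>]] by auto
    qed (use cd adj_sym[OF cd(1)] in \<open>auto simp: add.commute\<close>)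
    then show ?thesis using adjD(3)[OF cd(1)] by simp
  qed
  have "{(v, b). adj v b \<and> v + b \<in> S} = (\<Union>u\<in>S. {(v, b). adj v b \<and> v + b = u})"
    by auto
  then have "card {(v, b). adj v b \<and> v + b \<in> S} = (\<Sum>u\<in>S. card {(v, b). adj v b \<and> v + b = u})"
    by (simp only:) (rule card_UN_disjoint, auto)
  then show ?thesis by (simp add: two)
qed

definition pairs :: "('a \<times> 'a) set" where
  "pairs = {(v, b). adj v b}"

lemma pairs_Sigma: "pairs = Sigma A nb"
  by (auto simp: pairs_def nb_def dest: adjD)

lemma card_pairs_all: "card pairs = 2 * card U"
proof -
  have "pairs = {(v, b). adj v b \<and> v + b \<in> U}"
    by (auto simp: pairs_def adj_in_U)
  then show ?thesis using card_pairs[of U] by simp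
qed

lemma sum_pairs_fst: "(\<Sum>(v, b)\<in>pairs. F v) = (\<Sum>v\<in>A. deg v * (F v :: real))"
  unfolding pairs_Sigma by (subst sum.Sigma[symmetric]) (auto simp: deg_def)

lemma sum_pairs_snd: "(\<Sum>(v, b)\<in>pairs. F b) = (\<Sum>v\<in>A. deg v * (F v :: real))"
proof -
  have "(\<Sum>(v, b)\<in>pairs. F b) = (\<Sum>(v, b)\<in>pairs. F v)"
    by (rule sum.reindex_bij_witness[of _ prod.swap prod.swap]) (auto simp: pairs_def dest: adj_sym)
  then show ?thesis by (simp add: sum_pairs_fst)
qed

lemma sum_deg: "(\<Sum>v\<in>A. real (deg v)) = 2 * real (card U)"
proof -
  have "(\<Sum>v\<in>A. deg v) = card pairs"
    by (simp add: pairs_Sigma deg_def)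
  then have "real (\<Sum>v\<in>A. deg v) = real (2 * card U)"
    by (simp only: card_pairs_all)
  then show ?thesis by simp
qed

text \<open>\<open>card A\<close> is the sum of \<open>1 / deg a + 1 / deg b\<close> over all edges.
  For degrees at least 1 with sum at least \<open>s\<close> this weight is largest at degrees
  \<open>1\<close> and \<open>s - 1\<close>, where it is \<open>s / (s - 1)\<close>.\<close>

lemma deg_sum_bound:
  assumes nonisol: "\<And>a. a \<in> A \<Longrightarrow> \<exists>b. adj a b" and s: "2 \<le> s"
    and edge: "\<And>a b. adj a b \<Longrightarrow> s \<le> real (deg a + deg b)"
  shows "real (card A) * (s - 1) \<le> real (card U) * s"
proof -
  have ineq: "1 / real (deg v) + 1 / real (deg b) \<le> s / (s - 1)" if "adj v b" for v b
  proof -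
    define x y where "x = real (deg v)" and "y = real (deg b)"
    have xy: "1 \<le> x" "1 \<le> y" "s \<le> x + y"
      using deg_pos[OF that] deg_pos[OF adj_sym[OF that]] edge[OF that] by (auto simp: x_def y_def)
    have "0 \<le> (x - 1) * (y - 1)" using xy by simp
    then have "x + y - 1 \<le> x * y" by (simp add: algebra_simps)
    then have "(x + y - 1) * s \<le> x * y * s" using s by (intro mult_right_mono) auto
    then have "(x + y) * (s - 1) \<le> s * (x * y)" using xy by (simp add: algebra_simps)
    then have "1 / x + 1 / y \<le> s / (s - 1)" using xy s by (simp add: field_simps)
    then show ?thesis by (simp add: x_def y_def)
  qed
  have one: "(\<Sum>v\<in>A. real (deg v) * (1 / real (deg v))) = card A"
  proof -
    have "real (deg v) * (1 / real (deg v)) = 1" if "v \<in> A" for v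
      using nonisol[OF that] deg_pos by fastforce
    then show ?thesis by simp
  qed
  have "2 * real (card A) = (\<Sum>(v, b)\<in>pairs. 1 / real (deg v)) + (\<Sum>(v, b)\<in>pairs. 1 / real (deg b))"
    unfolding sum_pairs_fst sum_pairs_snd one by simp
  also have "\<dots> = (\<Sum>(v, b)\<in>pairs. 1 / real (deg v) + 1 / real (deg b))"
    by (simp add: sum.distrib case_prod_unfold)
  also have "\<dots> \<le> (\<Sum>(v, b)\<in>pairs. s / (s - 1))"
    by (intro sum_mono) (auto simp: pairs_def ineq)
  also have "\<dots> = 2 * real (card U) * (s / (s - 1))"
    by (simp add: card_pairs_all)
  finally show ?thesis using s by (simp add: field_simps)
qed

end

section \<open>Large graphs without isolated vertices\<close>

text \<open>
  For \<open>r \<le> 6\<close> the hypotheses on \<open>a\<close> and \<open>w\<close> are contradictory.  For \<open>r = 7, 8\<close> the polynomial estimate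
  behind the general case fails over the reals, but only finitely many integral \<open>a, w\<close> remain.
\<close>

lemma few_sums_arith:
  fixes a w r :: nat
  assumes large: "11 / 36 * 2 ^ r + 3 < real a" and aw: "a \<le> 2 * w" and few: "2 * (a + w) \<le> 2 ^ r + 4"
    and main: "(real w + \<mu>) * (real w * real w - real w) \<le> (real w - \<mu>) * (real a * real a - real a)
      + real w * ((3 * (2 * real w - real a) + 2)\<^sup>2 / 4 + (2 * real w - real a))"
    and mu: "\<mu> = 2 * real a - 2 ^ r / 2 - 8"
  shows False
proof -
  have "11 * 2 ^ r + 108 < 36 * real a" using large by simp
  then have "real (11 * 2 ^ r + 108) < real (36 * a)" by simp
  then have L: "11 * 2 ^ r + 108 < 36 * a" by (simp only: of_nat_less_iff)
  consider "r \<le> 6" | "r = 7" | "r = 8" | "9 \<le> r" by linarith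
  then show False
  proof cases
    case 1
    then have "r = 0 \<or> r = 1 \<or> r = 2 \<or> r = 3 \<or> r = 4 \<or> r = 5 \<or> r = 6" by auto
    then show False using L aw few by (elim disjE; simp) presburger
  next
    case 2
    have "1516 < 36 * a" "2 * (a + w) \<le> 132" using L few 2 by simp_all
    then have "a = 43 \<or> a = 44" "w = 22 \<or> w = 23" "a + w \<le> 66" using aw by presburger+
    then show False using main mu 2 by (elim disjE) (simp_all add: power2_eq_square)
  next
    case 3
    have "2924 < 36 * a" "2 * (a + w) \<le> 260" using L few 3 by simp_all
    then have "a = 82 \<or> a = 83 \<or> a = 84 \<or> a = 85 \<or> a = 86"
      "w = 41 \<or> w = 42 \<or> w = 43 \<or> w = 44 \<or> w = 45 \<or> w = 46 \<or> w = 47 \<or> w = 48" "a + w \<le> 130" "a \<le> 2 * w"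
      using aw by presburger+
    then show False using main mu 3 by (elim disjE) (simp_all add: power2_eq_square)
  next
    case 4
    define A W t where "A = real a" and "W = real w" and "t = 2 * W - A"
    have n: "512 \<le> (2::real) ^ r" using power_increasing[OF 4, of "2::real"] by simp
    have L': "11 * 2 ^ r + 108 < 36 * A" using large by (simp add: A_def)
    have few': "2 * A + 2 * W \<le> 2 ^ r + 4"
    proof -
      have "real (2 * (a + w)) \<le> real (2 ^ r + 4)" using few by (rule of_nat_mono)
      then show ?thesis by (simp add: A_def W_def)
    qed
    have A: "100 \<le> A" using L' n by linarith
    have t0: "0 \<le> t" using aw by (simp add: t_def A_def W_def)
    have tT: "11 * t \<le> 3 * A - 64" using L' few' by (simp add: t_def)
    \<comment> \<open>The inequality \<open>main\<close> weakens as \<open>\<mu>\<close> decreases,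
      so \<open>\<mu>\<close> may be replaced by this lower bound.\<close>
    have m0: "4 * A - 34 \<le> 11 * \<mu>" using L' by (simp add: mu A_def)
    have W1: "0 \<le> W * W - W" "0 \<le> A * A - A"
      using t0 A mult_right_mono[of 1 W W] mult_right_mono[of 1 A A] by (auto simp: t_def)
    have "(11 * W + (4 * A - 34)) * (W * W - W) \<le> (11 * W + 11 * \<mu>) * (W * W - W)"
      using m0 W1 by (intro mult_right_mono) auto
    moreover have "(11 * W - 11 * \<mu>) * (A * A - A) \<le> (11 * W - (4 * A - 34)) * (A * A - A)"
      using m0 W1 by (intro mult_right_mono) auto
    moreover have "(11 * W + 11 * \<mu>) * (W * W - W) \<le> (11 * W - 11 * \<mu>) * (A * A - A)
      + 11 * W * ((3 * t + 2)\<^sup>2 / 4 + t)"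
      using main by (simp add: A_def W_def t_def algebra_simps)
    ultimately have "4 * ((11 * W + (4 * A - 34)) * (W * W - W)) \<le> 4 * ((11 * W - (4 * A - 34)) * (A * A - A))
      + 11 * W * ((3 * t + 2)\<^sup>2 + 4 * t)"
      by (simp add: algebra_simps)
    \<comment> \<open>Substituting \<open>W = (A + t) / 2\<close> leaves a cubic in \<open>A\<close>
      and \<open>t\<close>.\<close>
    moreover have "7 * A ^ 3 - 366 * A ^ 2 + 364 * A + (5 * A ^ 2 - 328 * A + 92) * t
        - ((58 * A + 266) * t ^ 2 + 88 * t ^ 3)
      = 2 * (4 * ((11 * W + (4 * A - 34)) * (W * W - W)) - 4 * ((11 * W - (4 * A - 34)) * (A * A - A))
          - 11 * W * ((3 * t + 2)\<^sup>2 + 4 * t))"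
      by (simp add: t_def algebra_simps power2_eq_square power3_eq_cube)
    ultimately have cubic: "7 * A ^ 3 - 366 * A ^ 2 + 364 * A + (5 * A ^ 2 - 328 * A + 92) * t
        \<le> (58 * A + 266) * t ^ 2 + 88 * t ^ 3"
      by argo
    define T where "T = (3 * A - 64) / 11"
    have tT': "t \<le> T" using tT by (simp add: T_def)
    have T0: "0 \<le> T" using A by (simp add: T_def)
    \<comment> \<open>The value at \<open>t = T\<close> of the factor multiplying \<open>t\<close>
      once all terms with \<open>t\<close> in \<open>cubic\<close> are moved to the right. This
      factor increases with \<open>t\<close> for nonnegative \<open>t\<close>.\<close>
    define B where "B = (58 * A + 266) * T + 88 * T ^ 2 - (5 * A ^ 2 - 328 * A + 92)"
    have Beq: "11 * B = 191 * A ^ 2 - 2378 * A + 14732"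
      by (simp add: B_def T_def power2_eq_square field_simps)
    have "0 \<le> 191 * A ^ 2 - 2378 * A"
      using A mult_right_mono[of 100 A A] by (simp add: power2_eq_square)
    then have B0: "0 \<le> B" using Beq by simp
    have "(58 * A + 266) * t \<le> (58 * A + 266) * T"
      using tT' A by (intro mult_left_mono) auto
    moreover have "t ^ 2 \<le> T ^ 2" using tT' t0 by (intro power_mono) auto
    ultimately have "(58 * A + 266) * t + 88 * t ^ 2 - (5 * A ^ 2 - 328 * A + 92) \<le> B"
      by (simp add: B_def)
    then have "((58 * A + 266) * t + 88 * t ^ 2 - (5 * A ^ 2 - 328 * A + 92)) * t \<le> B * t"
      using t0 by (intro mult_right_mono) auto
    also have "\<dots> \<le> B * T" using B0 tT' by (intro mult_left_mono) auto
    finally have "7 * A ^ 3 - 366 * A ^ 2 + 364 * A \<le> B * T"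
      using cubic by (simp add: algebra_simps power2_eq_square power3_eq_cube)
    then have "121 * (7 * A ^ 3 - 366 * A ^ 2 + 364 * A) \<le> (11 * B) * (3 * A - 64)"
      by (simp add: T_def)
    then have "A * (A * (274 * A - 24928) - 152344) + 942848 \<le> 0"
      unfolding Beq by (simp add: algebra_simps power2_eq_square power3_eq_cube)
    moreover have "100 * 2472 \<le> A * (274 * A - 24928)"
      using A by (intro mult_mono) auto
    then have "0 \<le> A * (A * (274 * A - 24928) - 152344)" using A by simp
    ultimately show False by linarith
  qed
qed

lemma sum_card_translates:
  fixes S T :: "'a::boolean_group set"
  shows "(\<Sum>x\<in>UNIV. card {u \<in> S. u + x \<in> T}) = card S * card T"
proof -
  have "card {x. u + x \<in> T} = card T" for u
    using card_translate[of "\<lambda>x. x \<in> T" u] by (simp add: add.commute)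
  then have "(\<Sum>x\<in>UNIV. card {u \<in> S. u + x \<in> T}) = (\<Sum>u\<in>S. card T)"
    by (intro sum_multicount_gen) auto
  then show ?thesis by simp
qed

locale large_graph = sum_graph A for A :: "'a::boolean_group set" +
  fixes r :: nat
  assumes CARD_eq: "CARD('a) = 2 ^ r"
    and large: "11 / 36 * 2 ^ r + 3 < real (card A)"
    and nonisolated: "a \<in> A \<Longrightarrow> \<exists>b. adj a b"
begin

lemma large': "11 * real CARD('a) + 108 < 36 * real (card A)"
  using large by (simp add: CARD_eq field_simps)

lemma large_sum_free: "CARD('a) + 12 < 4 * card A"
proof -
  have "real (CARD('a) + 12) < real (4 * card A)"
    using large' by simp
  then show ?thesis by (simp only: of_nat_less_iff)
qed

lemmas sum_free = sum_free_U[OF large_sum_free]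

text \<open>Two sums of a triangle add up to the third, and \<open>U\<close> is sum-free.\<close>

lemma triangle_free:
  assumes "adj a b" "adj b c"
  shows "\<not> adj a c"
proof
  assume "adj a c"
  moreover have "(a + b) + (b + c) = a + c" by (simp add: add.assoc)
  ultimately show False
    using sum_free[OF adj_in_U[OF assms(1)] adj_in_U[OF assms(2)]] adj_in_U by metis
qed

section \<open>Many unique sums: a universal vertex\<close>

lemma double_star:
  assumes g: "g1 \<in> A" "g2 \<in> A" "g1 \<noteq> g2"
    and dom: "\<And>x. x \<in> A \<Longrightarrow> x \<noteq> g1 \<Longrightarrow> x \<noteq> g2 \<Longrightarrow> adj g1 x \<or> adj g2 x"
  shows "\<exists>g\<in>A. \<forall>x\<in>A - {g}. adj g x"
proof (rule ccontr)
  assume no: "\<not> ?thesis"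
  define A' where "A' = A - {g1, g2}"
  have cA': "card A' = card A - 2"
    using g by (simp add: A'_def card_Diff_subset)
  \<comment> \<open>If \<open>b\<close> is adjacent to \<open>g1\<close>, then
    \<open>g2 + (b + g1 + g2)\<close> would be a second representation of \<open>g1 + b\<close>;
    likewise with \<open>g1\<close> and \<open>g2\<close> exchanged.\<close>
  have shift: "b + (g1 + g2) \<notin> A" if "b \<in> A'" for b
  proof
    assume b': "b + (g1 + g2) \<in> A"
    have b: "b \<in> A" "b \<noteq> g1" "b \<noteq> g2" using that by (auto simp: A'_def)
    then consider "adj g1 b" | "adj g2 b" using dom by blast
    then show False
    proof cases
      case 1
      then show False
        using adj_unique[OF 1 g(2) b'] g(3) b by (simp add: ac_simps)
    next
      case 2
      then show False
        using adj_unique[OF 2 g(1) b'] g(3) b by (simp add: ac_simps)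
    qed
  qed
  have g12: "adj g1 g2"
  proof -
    have "c = g1 \<or> c = g2" if "c \<in> A" "d \<in> A" "c + d = g1 + g2" for c d
    proof -
      have "d = c + (g1 + g2)" using that(3) by (metis add_self_left)
      then show ?thesis using shift[of c] that by (auto simp: A'_def)
    qed
    then show ?thesis using g by (auto simp: adj_def)
  qed
  define B1 where "B1 = {b \<in> A'. adj g1 b}"
  define B2 where "B2 = A' - B1"
  have adj1: "adj g1 b" if "b \<in> B1" for b using that by (simp add: B1_def)
  have adj2: "adj g2 b" if "b \<in> B2" for b
    using that dom by (auto simp: B1_def B2_def A'_def)
  have BA: "B1 \<subseteq> A'" "B2 \<subseteq> A'" by (auto simp: B1_def B2_def)
  have "B1 \<noteq> {}"
  proof
    assume "B1 = {}"
    then have "\<forall>x\<in>A - {g2}. adj g2 x"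
      using adj2 adj_sym[OF g12] by (auto simp: B2_def A'_def)
    then show False using no g by auto
  qed
  moreover have "B2 \<noteq> {}"
  proof
    assume "B2 = {}"
    then have "\<forall>x\<in>A - {g1}. adj g1 x"
      using adj1 g12 by (auto simp: B2_def A'_def)
    then show False using no g by auto
  qed
  ultimately have ne: "B1 \<noteq> {}" "B2 \<noteq> {}" by auto
  \<comment> \<open>Adding \<open>{g1, g2}\<close> doubles both classes, so the density 3/5 in
    \<open>two_class_bound\<close> becomes 3/10 for \<open>A\<close>, which is below 11/36.\<close>
  define C where "C B = (+) g1 ` B \<union> (+) g2 ` B" for B
  have shift': "g1 + b \<noteq> g2 + c" if "b \<in> A'" "c \<in> A'" for b c
  proof
    assume eq: "g1 + b = g2 + c"
    have "c = b + (g1 + g2)"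
      using arg_cong[OF eq, of "\<lambda>t. t + g2"] by (simp add: ac_simps)
    then show False using shift[OF that(1)] that(2) by (auto simp: A'_def)
  qed
  have cC: "card (C B) = 2 * card B" if "B \<subseteq> A'" for B
  proof -
    have "(+) g1 ` B \<inter> (+) g2 ` B = {}"
      using shift' that by blast
    then show ?thesis by (simp add: C_def card_Un_disjoint card_translate_image)
  qed
  have disj: "C B1 \<inter> C B2 = {}"
    using shift' shift'[THEN not_sym] BA by (auto simp: C_def B2_def)
  \<comment> \<open>A sum of three elements of \<open>{g1, g2}\<close> is again one of them. A
    violation therefore gives \<open>c + e = g1 + b\<close> or \<open>b + e = g2 + c\<close>, a
    second representation of the sum of an edge.\<close>
  have avoid: "x + y \<notin> C B1 \<union> C B2" if xy: "x \<in> C B1" "y \<in> C B2" for x y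
  proof
    assume "x + y \<in> C B1 \<union> C B2"
    then obtain h e where e: "h \<in> {g1, g2}" "e \<in> A'" "x + y = h + e"
      using BA by (auto simp: C_def)
    obtain h1 b where b: "h1 \<in> {g1, g2}" "b \<in> B1" "x = h1 + b"
      using xy by (auto simp: C_def)
    obtain h2 c where c: "h2 \<in> {g1, g2}" "c \<in> B2" "y = h2 + c"
      using xy by (auto simp: C_def)
    have "h + h1 + h2 \<in> {g1, g2}"
      using e(1) b(1) c(1) by (auto simp: ac_simps)
    moreover have "h + h1 + h2 = b + c + e"
      using arg_cong[OF e(3), of "\<lambda>t. t + (h1 + h2 + e)"] b(3) c(3) by (simp add: ac_simps)
    ultimately consider "b + c + e = g1" | "b + c + e = g2" by auto
    then show False
    proof cases
      case 1
      have "c + e = (b + c + e) + b" by (simp add: ac_simps)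
      then have "c + e = g1 + b" unfolding 1 .
      then show False
        using adj_unique[OF adj1[OF b(2)], of c e] c(2) e(2) b(2) BA by (auto simp: A'_def B2_def)
    next
      case 2
      have "b + e = (b + c + e) + c" by (simp add: ac_simps)
      then have "b + e = g2 + c" unfolding 2 .
      then show False
        using adj_unique[OF adj2[OF c(2)], of b e] c(2) e(2) b(2) BA by (auto simp: A'_def B2_def)
    qed
  qed
  have "card B1 + card B2 = card A'"
    using BA(1) by (simp add: B2_def card_Diff_subset card_mono)
  then have sum: "card (C B1) + card (C B2) = 2 * (card A - 2)"
    using cC BA by (simp add: cA' flip: add_mult_distrib2)
  have neC: "C B1 \<noteq> {}" "C B2 \<noteq> {}" using ne by (auto simp: C_def)
  have "5 * (card (C B1) + card (C B2)) \<le> 3 * CARD('a)"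
  proof (cases "card (C B1) \<le> card (C B2)")
    case True
    show ?thesis by (rule two_class_bound[OF disj neC avoid True])
  next
    case False
    have "5 * (card (C B2) + card (C B1)) \<le> 3 * CARD('a)"
    proof (rule two_class_bound)
      show "b + c \<notin> C B2 \<union> C B1" if "b \<in> C B2" "c \<in> C B1" for b c
        using avoid[OF that(2,1)] by (simp add: add.commute Un_commute)
    qed (use disj neC False in auto)
    then show ?thesis by (simp add: add.commute)
  qed
  then have "10 * real (card A - 2) \<le> 3 * real CARD('a)"
    unfolding sum by linarith
  then show False using large' by linarith
qed

text \<open>The degrees of the six endpoints add up to at most \<open>card U + 9\<close>. Adding
  \<open>edge_bound\<close> for the three edges then limits the density of \<open>A\<close> to about
  3/10.\<close>

lemma no_three_disjoint_edges:
  assumes w: "card A \<le> card U + 2"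
    and e: "adj a1 b1" "adj a2 b2" "adj a3 b3"
    and d: "distinct [a1, b1, a2, b2, a3, b3]"
  shows False
proof -
  define X where "X = {a1, b1, a2, b2, a3, b3}"
  have XA: "X \<subseteq> A" using e by (auto simp: X_def dest: adjD)
  have cX: "card X = 6" using d by (simp add: X_def)
  define S where "S = {v + b | v b. v \<in> X \<and> b \<in> X \<and> adj v b}"
  \<comment> \<open>Edges inside \<open>X\<close> are counted in both orders, edges leaving
    \<open>X\<close> only once. The latter have distinct sums, all outside \<open>S\<close>.\<close>
  define Ti where "Ti = (SIGMA v:X. nb v \<inter> X)"
  define To where "To = (SIGMA v:X. nb v - X)"
  \<comment> \<open>In a triangle-free graph \<open>v\<close> is adjacent to at most one end of each
    of the three edges covering \<open>X\<close>.\<close>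
  have three: "card (nb v \<inter> X) \<le> 3" if v: "v \<in> X" for v
  proof -
    have one: "card (nb v \<inter> {a, b}) \<le> 1" if "adj a b" for a b
    proof -
      have "\<not> (a \<in> nb v \<and> b \<in> nb v)"
        using triangle_free[OF _ that, of v] by (auto simp: nb_def)
      then have "nb v \<inter> {a, b} \<subseteq> {a} \<or> nb v \<inter> {a, b} \<subseteq> {b}" by auto
      then show ?thesis
        using card_mono[of "{a}" "nb v \<inter> {a, b}"] card_mono[of "{b}" "nb v \<inter> {a, b}"] by force
    qed
    have eq: "nb v \<inter> X = (nb v \<inter> {a1, b1}) \<union> (nb v \<inter> {a2, b2}) \<union> (nb v \<inter> {a3, b3})"
      by (auto simp: X_def)
    have "card (nb v \<inter> X) \<le> card (nb v \<inter> {a1, b1}) + card (nb v \<inter> {a2, b2}) + card (nb v \<inter> {a3, b3})"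
      unfolding eq using card_Un_le[of "(nb v \<inter> {a1, b1}) \<union> (nb v \<inter> {a2, b2})" "nb v \<inter> {a3, b3}"]
        card_Un_le[of "nb v \<inter> {a1, b1}" "nb v \<inter> {a2, b2}"] by linarith
    then show ?thesis using one[OF e(1)] one[OF e(2)] one[OF e(3)] by linarith
  qed
  have SU: "S \<subseteq> U" by (auto simp: S_def U_def)
  have "Ti = {(v, b). adj v b \<and> v + b \<in> S}"
  proof (intro set_eqI iffI)
    fix p assume "p \<in> {(v, b). adj v b \<and> v + b \<in> S}"
    then obtain v b v' b' where p: "p = (v, b)" "adj v b" "v' \<in> X" "b' \<in> X" "adj v' b'" "v + b = v' + b'"
      by (auto simp: S_def)
    then have "v \<in> X \<and> b \<in> X"
      using adj_unique[OF p(5) adjD(1,2)[OF p(2)] p(6)] by auto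
    then show "p \<in> Ti" using p by (auto simp: Ti_def nb_def)
  qed (auto simp: Ti_def S_def nb_def)
  then have cTi: "card Ti = 2 * card S" using card_pairs[OF SU] by simp
  have "card Ti = (\<Sum>v\<in>X. card (nb v \<inter> X))" by (simp add: Ti_def)
  also have "\<dots> \<le> card X * 3"
    using sum_bounded_above[of X "\<lambda>v. card (nb v \<inter> X)" 3] three by simp
  finally have cS: "card S \<le> 9" using cTi cX by simp
  have inj: "inj_on (\<lambda>(v, b). v + b) To"
  proof (rule inj_onI)
    fix p q assume pq: "p \<in> To" "q \<in> To" "(\<lambda>(v, b). v + b) p = (\<lambda>(v, b). v + b) q"
    obtain v b v' b' where p: "p = (v, b)" "q = (v', b')" by fastforce
    have "adj v b" "adj v' b'" "v + b = v' + b'" "v \<in> X" "b \<notin> X" "v' \<in> X" "b' \<notin> X"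
      using pq by (auto simp: p To_def nb_def)
    then show "p = q"
      using adj_unique[of v' b' v b] adjD[of v b] p by auto
  qed
  have "(\<lambda>(v, b). v + b) ` To \<subseteq> U - S"
  proof
    fix u assume "u \<in> (\<lambda>(v, b). v + b) ` To"
    then obtain v b where vb: "u = v + b" "v \<in> X" "adj v b" "b \<notin> X" by (auto simp: To_def nb_def)
    have "u \<notin> S"
    proof
      assume "u \<in> S"
      then obtain v' b' where "v' \<in> X" "b' \<in> X" "adj v' b'" "v + b = v' + b'"
        using vb(1) by (auto simp: S_def)
      then show False using adj_unique[of v' b' v b] adjD[OF vb(3)] vb(4) by auto
    qed
    then show "u \<in> U - S" using vb adj_in_U by auto
  qed
  then have "card ((\<lambda>(v, b). v + b) ` To) \<le> card (U - S)" by (intro card_mono) auto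
  then have cTo: "card To \<le> card U - card S"
    using card_image[OF inj] SU by (simp add: card_Diff_subset)
  have "(\<Sum>v\<in>X. deg v) = card Ti + card To"
  proof -
    have "deg v = card (nb v \<inter> X) + card (nb v - X)" for v
      by (simp add: deg_def card_Int_Diff)
    then show ?thesis by (simp add: Ti_def To_def sum.distrib)
  qed
  also have "\<dots> \<le> card U + 9"
    using cTi cTo cS card_mono[OF _ SU] by simp
  finally have "deg a1 + deg b1 + deg a2 + deg b2 + deg a3 + deg b3 \<le> card U + 9"
    using d by (simp add: X_def)
  then have "real (deg a1 + deg b1 + deg a2 + deg b2 + deg a3 + deg b3) \<le> real (card U + 9)"
    by (rule of_nat_mono)
  then have "3 * (real (card A) + card U) \<le> 3 * (CARD('a) / 2) + card U + 9"
    using edge_bound[OF large_sum_free e(1)] edge_bound[OF large_sum_free e(2)]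
      edge_bound[OF large_sum_free e(3)] by simp
  moreover have "real (card A) \<le> real (card U) + 2" using w by linarith
  ultimately show False using large' by simp
qed

text \<open>A vertex not adjacent to \<open>a\<close> has an edge avoiding \<open>a\<close>, which
  is disjoint from \<open>ab\<close> unless it ends in \<open>b\<close>. Arguing from
  \<open>b\<close> in the same way leaves only the case of one edge ending in \<open>b\<close> and
  one in \<open>a\<close>, and these two are disjoint.\<close>

lemma two_disjoint_edges:
  assumes "\<not> (\<exists>g\<in>A. \<forall>x\<in>A - {g}. adj g x)"
  obtains a1 b1 a2 b2 where "adj a1 b1" "adj a2 b2" "distinct [a1, b1, a2, b2]"
proof -
  have "A \<noteq> {}" using large' by auto
  then obtain a b where ab: "adj a b" using nonisolated by blast
  have other: "\<exists>c d. c \<noteq> g \<and> \<not> adj g c \<and> adj c d" if "g \<in> A" for g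
    using assms that nonisolated by blast
  obtain c d where c: "c \<noteq> a" "\<not> adj a c" "adj c d" using other[OF adjD(1)[OF ab]] by blast
  obtain c' d' where c': "c' \<noteq> b" "\<not> adj b c'" "adj c' d'" using other[OF adjD(2)[OF ab]] by blast
  have da: "d \<noteq> a" using c adj_sym by blast
  have db: "d' \<noteq> b" using c' adj_sym by blast
  have cb: "c \<noteq> b" using c ab by blast
  have ca: "c' \<noteq> a" using c' ab adj_sym by blast
  show ?thesis
  proof (cases "d = b")
    case False
    then show ?thesis
      using that[OF ab c(3)] adjD(3)[OF ab] adjD(3)[OF c(3)] c da cb by auto
  next
    case True
    show ?thesis
    proof (cases "d' = a")
      case False
      then show ?thesis
        using that[OF ab c'(3)] adjD(3)[OF ab] adjD(3)[OF c'(3)] c' db ca by auto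
    next
      case d'a: True
      have "c \<noteq> c'" using c c' True d'a adj_sym by blast
      then show ?thesis
        using that[OF c(3) c'(3)] adjD(3)[OF c(3)] adjD(3)[OF c'(3)] True d'a c c' ab adjD(3)[OF ab]
        by auto
    qed
  qed
qed

lemma universal_vertex_of_many_sums:
  assumes w: "card A \<le> card U + 2"
  shows "\<exists>g\<in>A. \<forall>x\<in>A - {g}. adj g x"
proof (rule ccontr)
  assume no: "\<not> ?thesis"
  obtain a1 b1 a2 b2 where e: "adj a1 b1" "adj a2 b2" and d: "distinct [a1, b1, a2, b2]"
    using two_disjoint_edges[OF no] .
  \<comment> \<open>If both ends of \<open>ab\<close> had neighbours \<open>x\<close>,
    \<open>y\<close> outside, these would differ for lack of triangles, and \<open>xa\<close>,
    \<open>yb\<close>, \<open>cd\<close> would be three disjoint edges.\<close>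
  have centre: "\<exists>g h. {g, h} = {a, b} \<and> (\<forall>x. x \<notin> {a, b, c, d} \<longrightarrow> \<not> adj x h)"
    if ab: "adj a b" and cd: "adj c d" and dist: "distinct [a, b, c, d]" for a b c d
  proof (rule ccontr)
    assume contra: "\<not> ?thesis"
    have *: "\<exists>x. x \<notin> {a, b, c, d} \<and> adj x h" if "{g, h} = {a, b}" for g h
      using contra that by blast
    obtain x where x: "x \<notin> {a, b, c, d}" "adj x a" using *[of b a] by blast
    obtain y where y: "y \<notin> {a, b, c, d}" "adj y b" using *[of a b] by blast
    have "x \<noteq> y" using triangle_free[OF x(2) ab] y by auto
    then show False
      using no_three_disjoint_edges[OF w x(2) y(2) cd] dist x y by auto
  qed
  obtain g1 h1 where 1: "{g1, h1} = {a1, b1}" "\<forall>x. x \<notin> {a1, b1, a2, b2} \<longrightarrow> \<not> adj x h1"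
    using centre[OF e d] by blast
  obtain g2 h2 where 2: "{g2, h2} = {a2, b2}" "\<forall>x. x \<notin> {a2, b2, a1, b1} \<longrightarrow> \<not> adj x h2"
  proof -
    have "distinct [a2, b2, a1, b1]" using d by auto
    then show ?thesis using that centre[OF e(2,1)] by blast
  qed
  have adj1: "adj g1 h1"
    using 1(1) e(1) adj_sym[OF e(1)] by (auto simp: doubleton_eq_iff)
  have adj2: "adj g2 h2"
    using 2(1) e(2) adj_sym[OF e(2)] by (auto simp: doubleton_eq_iff)
  have X: "{a1, b1, a2, b2} = {g1, h1, g2, h2}" using 1(1) 2(1) by auto
  have "\<exists>g\<in>A. \<forall>x\<in>A - {g}. adj g x"
  proof (rule double_star)
    show "g1 \<in> A" "g2 \<in> A" using adjD(1)[OF adj1] adjD(1)[OF adj2] by auto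
    show "g1 \<noteq> g2" using 1(1) 2(1) d by auto
    fix x assume x: "x \<in> A" "x \<noteq> g1" "x \<noteq> g2"
    show "adj g1 x \<or> adj g2 x"
    proof (cases "x \<in> {a1, b1, a2, b2}")
      case True
      then have "x = h1 \<or> x = h2" using X x by auto
      then show ?thesis using adj1 adj2 by auto
    next
      case False
      obtain y where y: "adj x y" using nonisolated x by blast
      have "y \<in> {a1, b1, a2, b2}"
      proof (rule ccontr)
        assume "y \<notin> {a1, b1, a2, b2}"
        then show False
          using no_three_disjoint_edges[OF w e y] d False adjD(3)[OF y] by auto
      qed
      moreover have "y \<noteq> h1" using 1(2) False y by auto
      moreover have "y \<noteq> h2" using 2(2) False y by auto
      ultimately show ?thesis using X adj_sym[OF y] by auto
    qed
  qed
  then show False using no by simp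
qed

section \<open>The dichotomy, and the exclusion of few unique sums\<close>

lemma few_or_many_sums:
  assumes "1 \<le> r"
  shows "2 * (card A + card U) \<le> CARD('a) + 4 \<or> card A \<le> card U + 2"
proof (rule ccontr)
  assume contra: "\<not> ?thesis"
  have m: "CARD('a) = 2 * 2 ^ (r - 1)"
    using assms by (cases r) (auto simp: CARD_eq)
  define m :: nat where "m = 2 ^ (r - 1)"
  note m = m[folded m_def]
  define a w s where "a = real (card A)" and "w = real (card U)" and "s = a + w - m"
  have "m + 3 \<le> card A + card U" using contra m by auto
  then have s3: "3 \<le> s" by (simp add: s_def a_def w_def)
  have "card U + 3 \<le> card A" using contra by auto
  then have sM: "s \<le> 2 * a - m - 3" by (simp add: s_def a_def w_def)
  have edge: "s \<le> real (deg v + deg b)" if "adj v b" for v b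
    using edge_bound[OF large_sum_free that] by (simp add: s_def a_def w_def m)
  have "a * (s - 1) \<le> w * s"
    unfolding a_def w_def using s3 by (intro deg_sum_bound nonisolated edge) auto
  then have "0 \<le> s * s - (2 * a - m) * s + a" by (simp add: s_def algebra_simps)
  \<comment> \<open>The convex quadratic takes the same value \<open>a - 3 * (2 * a - m - 3)\<close>
    at both ends of the range of \<open>s\<close>, so this value bounds it there.\<close>
  moreover have "0 \<le> (s - 3) * ((2 * a - m - 3) - s)"
    using s3 sM by simp
  ultimately have "0 \<le> a - 3 * (2 * a - m - 3)"
    by (simp add: algebra_simps)
  then show False using large' by (simp add: a_def m)
qed

lemma many_sums: "CARD('a) + 4 < 2 * (card A + card U)"
proof (rule ccontr)
  assume "\<not> ?thesis"
  then have few: "2 * (card A + card U) \<le> CARD('a) + 4" by simp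
  \<comment> \<open>The 8 in \<open>\<mu>\<close> is the error \<open>2 + 2 * 3\<close> of
    \<open>rep_lower\<close> for an edge with degree sum at most 3.\<close>
  define a w n \<mu> where "a = real (card A)" and "w = real (card U)" and "n = real CARD('a)"
    and "\<mu> = 2 * a - n / 2 - 8"
  have deg1: "1 \<le> deg v" if "v \<in> A" for v using nonisolated[OF that] deg_pos by blast
  define \<Xi> where "\<Xi> = 2 * w - a"
  have excess: "(\<Sum>v\<in>A. real (deg v) - 1) = \<Xi>"
    by (simp add: sum_subtractf sum_deg \<Xi>_def a_def w_def)
  have Xi0: "0 \<le> \<Xi>"
    unfolding excess[symmetric] using deg1 by (intro sum_nonneg) (simp add: Suc_le_eq)
  then have aw: "card A \<le> 2 * card U" by (simp add: \<Xi>_def a_def w_def)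
  have "A \<noteq> {}" using large' by auto
  define d where "d = Max (deg ` A)"
  have "d \<in> deg ` A" unfolding d_def using \<open>A \<noteq> {}\<close> by (intro Max_in) auto
  then obtain g where g: "g \<in> A" "deg g = d" by auto
  have degd: "deg v \<le> d" if "v \<in> A" for v using that by (simp add: d_def)
  have d1: "1 \<le> d" using deg1 g by auto
  have dXi: "real d - 1 \<le> \<Xi>"
    unfolding excess[symmetric] g(2)[symmetric]
    using deg1 g(1) by (intro member_le_sum) (auto simp: Suc_le_eq)

  \<comment> \<open>For sums with a summand in \<open>L\<close> the error terms of \<open>rep_lower\<close> are small enough; \<open>delta\<close> shows
    that the remaining sums are few.\<close>
  define L where "L = {v + b | v b. adj v b \<and> deg v + deg b \<le> 3}"
  define H where "H = U - L"
  define \<delta> where "\<delta> = real (card H)"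
  have LU: "L \<subseteq> U" by (auto simp: L_def U_def)
  have delta: "2 * \<delta> \<le> 3 * \<Xi> - d + 3"
  proof -
    \<comment> \<open>This edge weight totals \<open>2 * \<Xi>\<close>. It is at least
      \<open>1 - 1 / d\<close> on the \<open>2 * d\<close> ordered edges at a vertex of maximal
      degree, and at least 2/3 on edges with sum in \<open>H\<close>, whose degrees add up to at
      least 4.\<close>
    define c where "c p = (1 - 1 / real (deg (fst p))) + (1 - 1 / real (deg (snd p)))" for p :: "'a \<times> 'a"
    have degp: "1 \<le> deg v" "1 \<le> deg b" if "(v, b) \<in> pairs" for v b
      using that deg_pos[of v b] deg_pos[OF adj_sym, of v b] by (auto simp: pairs_def)
    have inv: "0 \<le> 1 - 1 / real k" if "1 \<le> k" for k :: nat
      using that by simp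
    have c0: "0 \<le> c p" if "p \<in> pairs" for p
      unfolding c_def using that degp[of "fst p" "snd p"] by (intro add_nonneg_nonneg inv) auto
    define P where "P = {(v, b). adj v b \<and> v + b \<in> H}"
    have cP: "card P = 2 * card H"
      unfolding P_def by (rule card_pairs) (auto simp: H_def)
    have Psub: "P \<subseteq> pairs" by (auto simp: P_def pairs_def)
    define G where "G = Pair g ` nb g \<union> (\<lambda>b. (b, g)) ` nb g"
    have Gsub: "G \<subseteq> pairs" by (auto simp: G_def pairs_def nb_def dest: adj_sym)
    have disj: "Pair g ` nb g \<inter> (\<lambda>b. (b, g)) ` nb g = {}"
      by (auto simp: nb_def dest: adjD)
    have cG: "card G = 2 * d"
      using disj by (simp add: G_def card_Un_disjoint card_image inj_on_def deg_def flip: g(2))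
    have "2 * \<Xi> = (\<Sum>p\<in>pairs. c p)"
    proof -
      have "(\<Sum>p\<in>pairs. c p) = (\<Sum>(v, b)\<in>pairs. 1 - 1 / real (deg v)) + (\<Sum>(v, b)\<in>pairs. 1 - 1 / real (deg b))"
        unfolding c_def case_prod_unfold by (rule sum.distrib)
      also have "\<dots> = 2 * (\<Sum>v\<in>A. real (deg v) * (1 - 1 / real (deg v)))"
        unfolding sum_pairs_fst sum_pairs_snd by simp
      also have "(\<Sum>v\<in>A. real (deg v) * (1 - 1 / real (deg v))) = (\<Sum>v\<in>A. real (deg v) - 1)"
      proof (rule sum.cong)
        fix v assume "v \<in> A"
        then show "real (deg v) * (1 - 1 / real (deg v)) = real (deg v) - 1"
          using deg1[of v] by (simp add: field_simps)
      qed simp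
      finally show ?thesis by (simp add: excess)
    qed
    also have "\<dots> \<ge> (\<Sum>p\<in>G \<union> (P - G). c p)"
      using Gsub Psub c0 by (intro sum_mono2) auto
    also have "(\<Sum>p\<in>G \<union> (P - G). c p) = (\<Sum>p\<in>G. c p) + (\<Sum>p\<in>P - G. c p)"
      by (intro sum.union_disjoint) auto
    finally have sum: "(\<Sum>p\<in>G. c p) + (\<Sum>p\<in>P - G. c p) \<le> 2 * \<Xi>" .
    have "real (card G) * (1 - 1 / real d) \<le> (\<Sum>p\<in>G. c p)"
    proof (rule sum_bounded_below)
      fix p assume p: "p \<in> G"
      then have "1 \<le> deg (fst p)" "1 \<le> deg (snd p)" "fst p = g \<or> snd p = g"
        using Gsub degp[of "fst p" "snd p"] by (auto simp: G_def)
      then show "1 - 1 / real d \<le> c p"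
        using g(2) inv[of "deg (fst p)"] inv[of "deg (snd p)"] unfolding c_def by fastforce
    qed
    moreover have "real (card G) * (1 - 1 / real d) = 2 * real d - 2"
      using d1 by (simp add: cG field_simps)
    ultimately have sG: "2 * real d - 2 \<le> (\<Sum>p\<in>G. c p)" by simp
    have "real (card (P - G)) * (2 / 3) \<le> (\<Sum>p\<in>P - G. c p)"
    proof (rule sum_bounded_below)
      fix p assume p: "p \<in> P - G"
      obtain v b where vb: "p = (v, b)" by (cases p)
      have adj: "adj v b" "v + b \<notin> L" using p vb by (auto simp: P_def H_def)
      then have "\<not> deg v + deg b \<le> 3" by (auto simp: L_def)
      define x y where "x = real (deg v)" and "y = real (deg b)"
      have xy: "1 \<le> x" "1 \<le> y" "4 \<le> x + y"
        using deg_pos[OF adj(1)] deg_pos[OF adj_sym[OF adj(1)]] \<open>\<not> deg v + deg b \<le> 3\<close>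
        by (auto simp: x_def y_def)
      have "0 \<le> (x - 1) * (y - 1)" using xy by simp
      then have "3 * (x + y) \<le> 4 * (x * y)" using xy by (simp add: algebra_simps)
      then have "1 / x + 1 / y \<le> 4 / 3" using xy by (simp add: field_simps)
      then show "2 / 3 \<le> c p" by (simp add: c_def vb x_def y_def)
    qed
    moreover have "2 * \<delta> - 2 * real d \<le> real (card (P - G))"
      using diff_card_le_card_Diff[of G P] by (simp add: cP cG \<delta>_def)
    ultimately show ?thesis using sum sG by argo
  qed

  define Q where "Q = {u + v | u v. u \<in> U \<and> v \<in> U \<and> u \<noteq> v}"
  define S where "S = {u + v | u v. u \<in> L \<and> v \<in> U \<and> u \<noteq> v}"
  have SI: "u + v \<in> S" if "u \<in> L" "v \<in> U" "u \<noteq> v" for u v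
    using that by (auto simp: S_def)
  have SQ: "S \<subseteq> Q" using LU by (auto simp: S_def Q_def)
  have QU: "x \<notin> U" if "x \<in> Q" for x using that sum_free by (auto simp: Q_def)
  have Q0: "0 \<notin> Q" by (auto simp: Q_def) (metis add_self_left add.right_neutral)
  have upper: "real (rep x) + urep x \<le> w + exc x" if "x \<in> Q" for x
    using rep_urep_upper[OF nonisolated QU[OF that]] that Q0 by (fastforce simp: w_def)
  have lowS: "real (urep x) + \<mu> \<le> rep x" if xS: "x \<in> S" for x
  proof -
    obtain c b v where x: "x = c + b + v" "adj c b" "deg c + deg b \<le> 3" "v \<in> U" "v \<noteq> c + b"
      using xS by (auto simp: S_def L_def)
    show ?thesis
      using rep_lower[OF large_sum_free x(2,4,5)] x(3) by (simp add: x(1) \<mu>_def a_def n_def)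
  qed
  have lowQ: "\<mu> \<le> rep x" if xQ: "x \<in> Q" for x
  proof -
    obtain u v where x: "x = u + v" "u \<in> U" "v \<in> U" using xQ by (auto simp: Q_def)
    show ?thesis
      using rep_lower_crude[OF x(2,3)] by (simp add: x(1) \<mu>_def a_def n_def)
  qed
  define y z q \<Theta> where "y = (\<Sum>x\<in>S. real (urep x))" and "z = (\<Sum>x\<in>Q - S. real (urep x))"
    and "q = real (card Q)" and "\<Theta> = (\<Sum>x\<in>Q. real (exc x))"
  have split: "(\<Sum>x\<in>Q. F x) = (\<Sum>x\<in>S. F x) + (\<Sum>x\<in>Q - S. F x)" for F :: "'a \<Rightarrow> real"
    using sum.subset_diff[OF SQ, of F] by simp
  have yz: "y + z = w * w - w"
  proof -
    have "urep x = 0" if "x \<notin> insert 0 Q" for x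
    proof -
      have "\<not> (u \<in> U \<and> u + x \<in> U)" for u
      proof
        assume u: "u \<in> U \<and> u + x \<in> U"
        have "u \<noteq> u + x" using that by auto
        moreover have "x = u + (u + x)" by simp
        ultimately have "x \<in> Q" using u unfolding Q_def by blast
        then show False using that by simp
      qed
      then show ?thesis by (simp add: urep_def)
    qed
    then have "(\<Sum>x\<in>UNIV. urep x) = (\<Sum>x\<in>insert 0 Q. urep x)"
      by (intro sum.mono_neutral_right) auto
    also have "\<dots> = card U + (\<Sum>x\<in>Q. urep x)"
      using Q0 by (simp add: urep_def)
    finally have "card U * card U = card U + (\<Sum>x\<in>Q. urep x)"
      using sum_card_translates[of U U] by (simp add: urep_def)
    then have "real (card U * card U) = real (card U + (\<Sum>x\<in>Q. urep x))" by simp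
    then show ?thesis using split[of "\<lambda>x. real (urep x)"] by (simp add: y_def z_def w_def)
  qed
  \<comment> \<open>For \<open>x\<close> outside \<open>S\<close>, only elements of \<open>H\<close>
    occur in representations of \<open>x\<close> as a sum of two elements of
    \<open>U\<close>.\<close>
  have zd: "z \<le> \<delta> * \<delta>"
  proof -
    have "urep x \<le> card {u \<in> H. u + x \<in> H}" if x: "x \<in> Q - S" for x
      unfolding urep_def
    proof (intro card_mono subsetI)
      fix u assume "u \<in> {u \<in> U. u + x \<in> U}"
      then have u: "u \<in> U" "u + x \<in> U" by auto
      have ne: "u \<noteq> u + x" using x Q0 by auto
      have "u \<notin> L"
      proof
        assume "u \<in> L"
        then have "u + (u + x) \<in> S" using u ne by (intro SI)
        then show False using x by simp
      qed
      moreover have "u + x \<notin> L"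
      proof
        assume "u + x \<in> L"
        then have "(u + x) + u \<in> S" using u ne[symmetric] by (intro SI)
        then show False using x by (simp add: ac_simps)
      qed
      ultimately show "u \<in> {u \<in> H. u + x \<in> H}" using u by (simp add: H_def)
    qed simp
    then have "(\<Sum>x\<in>Q - S. urep x) \<le> (\<Sum>x\<in>Q - S. card {u \<in> H. u + x \<in> H})"
      by (intro sum_mono)
    also have "\<dots> \<le> (\<Sum>x\<in>UNIV. card {u \<in> H. u + x \<in> H})"
      by (intro sum_mono2) auto
    also have "\<dots> = card H * card H" by (rule sum_card_translates)
    finally have "real (\<Sum>x\<in>Q - S. urep x) \<le> real (card H * card H)" by (rule of_nat_mono)
    then show ?thesis by (simp add: z_def \<delta>_def)
  qed
  \<comment> \<open>Of the \<open>deg b * deg b\<close> ordered pairs of neighbours of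
    \<open>b\<close>, \<open>deg b\<close> have sum 0, which is not in \<open>Q\<close>.\<close>
  have Theta: "\<Theta> \<le> d * \<Xi>"
  proof -
    have "(\<Sum>x\<in>Q. real (card {v \<in> nb b. v + x \<in> nb b})) \<le> d * (real (deg b) - 1)" if b: "b \<in> A" for b
    proof -
      have "deg b + (\<Sum>x\<in>Q. card {v \<in> nb b. v + x \<in> nb b}) = (\<Sum>x\<in>insert 0 Q. card {v \<in> nb b. v + x \<in> nb b})"
        using Q0 by (simp add: deg_def)
      also have "\<dots> \<le> (\<Sum>x\<in>UNIV. card {v \<in> nb b. v + x \<in> nb b})"
        by (intro sum_mono2) auto
      also have "\<dots> = deg b * deg b" by (simp add: sum_card_translates deg_def)
      finally have "real (deg b + (\<Sum>x\<in>Q. card {v \<in> nb b. v + x \<in> nb b})) \<le> real (deg b * deg b)"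
        by (rule of_nat_mono)
      then have "(\<Sum>x\<in>Q. real (card {v \<in> nb b. v + x \<in> nb b})) \<le> deg b * (real (deg b) - 1)"
        by (simp add: algebra_simps)
      also have "\<dots> \<le> d * (real (deg b) - 1)"
        using deg1[OF b] degd[OF b] by (intro mult_right_mono) auto
      finally show ?thesis .
    qed
    then have "(\<Sum>b\<in>A. \<Sum>x\<in>Q. real (card {v \<in> nb b. v + x \<in> nb b})) \<le> (\<Sum>b\<in>A. d * (real (deg b) - 1))"
      by (intro sum_mono)
    moreover have "\<Theta> = (\<Sum>b\<in>A. \<Sum>x\<in>Q. real (card {v \<in> nb b. v + x \<in> nb b}))"
      unfolding \<Theta>_def exc_def of_nat_sum by (rule sum.swap)
    ultimately show ?thesis by (simp add: excess flip: sum_distrib_left)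
  qed
  have repQ: "(\<Sum>x\<in>Q. real (rep x)) \<le> a * a - a"
  proof -
    have "card A + (\<Sum>x\<in>Q. rep x) = (\<Sum>x\<in>insert 0 Q. rep x)"
      using Q0 by (simp add: rep_def)
    also have "\<dots> \<le> (\<Sum>x\<in>UNIV. rep x)" by (intro sum_mono2) auto
    also have "\<dots> = card A * card A" by (simp add: rep_def sum_card_translates)
    finally have "real (card A + (\<Sum>x\<in>Q. rep x)) \<le> real (card A * card A)" by (rule of_nat_mono)
    then show ?thesis by (simp add: a_def)
  qed
  have cQ: "q = real (card S) + real (card (Q - S))"
    using card_mono[OF _ SQ] by (simp add: q_def card_Diff_subset[OF _ SQ])
  have budget: "y + \<mu> * q \<le> a * a - a"
  proof -
    have "(\<Sum>x\<in>S. real (urep x) + \<mu>) \<le> (\<Sum>x\<in>S. real (rep x))" by (intro sum_mono lowS)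
    moreover have "(\<Sum>x\<in>Q - S. \<mu>) \<le> (\<Sum>x\<in>Q - S. real (rep x))" by (intro sum_mono lowQ) auto
    ultimately show ?thesis
      using repQ split[of "\<lambda>x. real (rep x)"] by (simp add: sum.distrib y_def cQ algebra_simps)
  qed
  \<comment> \<open>Eliminates \<open>rep x\<close> between lower and upper bounds. On
    \<open>Q - S\<close> only \<open>lowQ\<close> is available, which leaves one copy of
    \<open>urep x\<close> instead of two.\<close>
  have weight: "2 * y + z - \<Theta> \<le> (w - \<mu>) * q"
  proof -
    have "(\<Sum>x\<in>S. 2 * real (urep x) - exc x) \<le> (\<Sum>x\<in>S. w - \<mu>)"
    proof (rule sum_mono)
      fix x assume "x \<in> S"
      then show "2 * real (urep x) - exc x \<le> w - \<mu>" using lowS[of x] upper[of x] SQ by auto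
    qed
    moreover have "(\<Sum>x\<in>Q - S. real (urep x) - exc x) \<le> (\<Sum>x\<in>Q - S. w - \<mu>)"
    proof (rule sum_mono)
      fix x assume "x \<in> Q - S"
      then show "real (urep x) - exc x \<le> w - \<mu>" using lowQ[of x] upper[of x] by auto
    qed
    ultimately show ?thesis
      using split[of "\<lambda>x. real (exc x)"]
      by (simp add: sum_subtractf y_def z_def \<Theta>_def cQ algebra_simps flip: sum_distrib_left)
  qed
  have few': "2 * a + 2 * w \<le> n + 4"
  proof -
    have "real (2 * (card A + card U)) \<le> real (CARD('a) + 4)" using few by (rule of_nat_mono)
    then show ?thesis by (simp add: a_def w_def n_def)
  qed
  have lrg: "11 * n + 108 < 36 * a" using large' by (simp add: a_def n_def)
  have mu0: "0 \<le> \<mu>" using lrg few' Xi0 by (simp add: \<mu>_def \<Xi>_def)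
  have muw: "\<mu> \<le> w" using few' Xi0 by (simp add: \<mu>_def \<Xi>_def)
  \<comment> \<open>The unknown \<open>q\<close> is eliminated between \<open>weight\<close> and
    \<open>budget\<close>, using that \<open>\<mu>\<close> and \<open>w - \<mu>\<close> are
    nonnegative.\<close>
  have "\<mu> * (2 * y + z - \<Theta>) \<le> \<mu> * ((w - \<mu>) * q)"
    using weight mu0 by (rule mult_left_mono)
  also have "\<dots> = (w - \<mu>) * (\<mu> * q)" by simp
  also have "\<dots> \<le> (w - \<mu>) * (a * a - a - y)"
    using budget muw by (intro mult_left_mono) auto
  finally have key: "\<mu> * (2 * y + z - \<Theta>) \<le> (w - \<mu>) * (a * a - a - y)" .
  have "(w + \<mu>) * (w * w - w) \<le> (w - \<mu>) * (a * a - a) + w * z + \<mu> * \<Theta>"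
    using key unfolding yz[symmetric] by (simp add: algebra_simps)
  moreover have "w * z + \<mu> * \<Theta> \<le> w * ((3 * \<Xi> + 2)\<^sup>2 / 4 + \<Xi>)"
  proof -
    have "0 \<le> w" by (simp add: w_def)
    have "4 * z \<le> (3 * \<Xi> - d + 3)\<^sup>2"
    proof -
      have "4 * z \<le> (2 * \<delta>)\<^sup>2" using zd by (simp add: power2_eq_square)
      also have "\<dots> \<le> (3 * \<Xi> - d + 3)\<^sup>2" using delta by (intro power_mono) (auto simp: \<delta>_def)
      finally show ?thesis .
    qed
    \<comment> \<open>The \<open>- d\<close> in \<open>delta\<close> pays for the
      \<open>d * \<Xi>\<close> in \<open>Theta\<close>, so the resulting bound no longer depends on
      \<open>d\<close>.\<close>
    moreover have "(3 * \<Xi> - d + 3)\<^sup>2 \<le> (3 * \<Xi> + 2)\<^sup>2 - 4 * (real d - 1) * \<Xi>"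
    proof -
      have "0 \<le> (real d - 1) * ((2 * \<Xi> + 5 - d))"
        using d1 dXi Xi0 by (intro mult_nonneg_nonneg) auto
      then show ?thesis by (simp add: power2_eq_square algebra_simps)
    qed
    ultimately have "4 * z + 4 * (d * \<Xi>) \<le> (3 * \<Xi> + 2)\<^sup>2 + 4 * \<Xi>"
      by (simp add: algebra_simps)
    then have "w * (z + d * \<Xi>) \<le> w * ((3 * \<Xi> + 2)\<^sup>2 / 4 + \<Xi>)"
      using \<open>0 \<le> w\<close> by (intro mult_left_mono) auto
    moreover have "\<mu> * \<Theta> \<le> w * (d * \<Xi>)"
      using mu0 muw Theta Xi0 \<open>0 \<le> w\<close> by (intro mult_mono) (auto simp: \<Theta>_def intro!: sum_nonneg)
    ultimately show ?thesis by (simp add: distrib_left)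
  qed
  ultimately have "(w + \<mu>) * (w * w - w) \<le> (w - \<mu>) * (a * a - a) + w * ((3 * \<Xi> + 2)\<^sup>2 / 4 + \<Xi>)"
    by linarith
  then show False
    using few_sums_arith[of r "card A" "card U" \<mu>] large aw few
    by (simp add: a_def w_def n_def \<mu>_def \<Xi>_def CARD_eq)
qed

end

section \<open>Round sets\<close>

text \<open>Deleting \<open>a\<close> loses some sum, all of whose representations then use
  \<open>a\<close>. It is not \<open>a + a = 0\<close>, because 0 is also \<open>c + c\<close> for a
  second element \<open>c\<close>.\<close>

lemma round_set_nonisolated:
  fixes A :: "'a::boolean_group set"
  assumes round: "round_set A" and two: "2 \<le> card A" and a: "a \<in> A"
  shows "\<exists>b. sum_graph.adj A a b"
proof -
  have "A - {a} \<subset> A" using a by auto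
  then have "(A - {a}) + (A - {a}) \<noteq> A + A"
    using round by (simp add: round_set_def)
  moreover have "(A - {a}) + (A - {a}) \<subseteq> A + A"
    by (intro set_plus_mono2) auto
  ultimately obtain s where s: "s \<in> A + A" "s \<notin> (A - {a}) + (A - {a})" by blast
  then obtain x y where xy: "x \<in> A" "y \<in> A" "s = x + y" by (auto elim: set_plus_elim)
  have rep: "c = a \<or> d = a" if "c \<in> A" "d \<in> A" "c + d = s" for c d
    using s(2) that set_plus_intro[of c "A - {a}" d "A - {a}"] by blast
  obtain b where b: "b \<in> A" "s = a + b"
    using rep[OF xy(1,2)] xy by (auto simp: add.commute)
  have "a \<noteq> b"
  proof
    assume "a = b"
    then have "s = 0" using b by simp
    have "A - {a} \<noteq> {}"
      using two card_mono[of "{a}" A] by fastforce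
    then obtain c where c: "c \<in> A" "c \<noteq> a" by auto
    then show False using rep[of c c] \<open>s = 0\<close> by simp
  qed
  moreover have "c = a \<or> c = b" if cd: "c \<in> A" "d \<in> A" "c + d = a + b" for c d
  proof -
    have "c = a \<or> d = a" using rep[OF cd(1,2)] cd(3) b(2) by simp
    then show ?thesis using cd(3) by (auto simp: add.commute)
  qed
  ultimately show ?thesis using a b(1) by (auto simp: sum_graph.adj_def)
qed

text \<open>Translating by \<open>g\<close> turns a relation \<open>s + t \<in> S\<close> into
  \<open>x + y = g + z\<close> with \<open>x\<close>, \<open>y\<close>, \<open>z\<close> in
  \<open>A - {g}\<close>, against the uniqueness of the sum \<open>g + z\<close>.\<close>

lemma sum_free_of_universal_vertex:
  fixes A :: "'a::boolean_group set"
  assumes g: "g \<in> A" and univ: "\<forall>x\<in>A - {g}. sum_graph.adj A g x"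
  shows "\<exists>S. sum_free S \<and> A = g +o (S \<union> {0})"
proof (intro exI conjI)
  define S where "S = (+) g ` (A - {g})"
  show "A = g +o (S \<union> {0})"
    using g by (auto simp: S_def elt_set_plus_def)
  have False if s: "s \<in> S" "t \<in> S" "s + t \<in> S" for s t
  proof -
    obtain x y z where xyz: "x \<in> A - {g}" "s = g + x" "y \<in> A - {g}" "t = g + y" "z \<in> A - {g}" "s + t = g + z"
      using s unfolding S_def by (elim imageE) blast
    have "x + y = s + t" by (simp add: xyz ac_simps)
    then have "x + y = g + z" using xyz(6) by simp
    then show False
      using sum_graph.adj_unique[OF univ[rule_format, OF xyz(5)], of x y] xyz by auto
  qed
  then show "sum_free S" by (auto simp: sum_free_def elim!: set_plus_elim)
qed

theorem theorem3p3:
  fixes A :: "(bit ^ 'r) set"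
  assumes "round_set A"
    and "real (card A) > 11 / 36 * 2 ^ CARD('r) + 3"
  shows "\<exists>(S :: (bit ^ 'r) set) (g :: bit ^ 'r). sum_free S \<and> A = g +o (S \<union> {0})"
proof -
  have "0 \<le> 11 / 36 * (2::real) ^ CARD('r)" by simp
  then have "2 \<le> card A" using assms(2) by linarith
  have bit: "(UNIV :: bit set) = {0, 1}" by (auto intro: bit.exhaust)
  have "CARD(bit) = 2" unfolding bit by simp
  then have card: "CARD(bit ^ 'r) = 2 ^ CARD('r)" by simp
  interpret large_graph A "CARD('r)"
    by unfold_locales (use assms card round_set_nonisolated[OF assms(1) \<open>2 \<le> card A\<close>] in auto)
  have "card A \<le> card U + 2"
    using few_or_many_sums many_sums by (metis One_nat_def Suc_leI not_le zero_less_card_finite)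
  then obtain g where "g \<in> A" "\<forall>x\<in>A - {g}. adj g x"
    using universal_vertex_of_many_sums by blast
  then show ?thesis using sum_free_of_universal_vertex by blast
qed

end
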